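(* Let $F:T^{1,0}M\to[0,+\infty)$ be a strongly convex complex Finsler metric on a complex manifold $M$, with associated Cartan connection $\nabla$, and let $\mathbf J$ be the canonical complex structure on the complex manifold $T^{1,0}M$. If $\nabla_X\mathbf J=0$ for all $X\in\mathcal H_{\mathbb R}$, then $F$ must be a Kähler-Berwald metric.
   Context: Standing conventions. $M$ is a complex manifold of complex dimension $n\ge 2$ with canonical complex structure $J$ on the real tangent bundle $T_{\mathbb R}M$. Greek indices run over $1,\dots,n$, Latin indices over $1,\dots,2n$, $\alpha^*=\alpha+n$, and repeated indices are summed. Local holomorphic coordinates are $z^\alpha=x^\alpha+ix^{\alpha^*}$, with fiber coordinates $v=v^\alpha\frac{\partial}{\partial z^\alpha}\in T^{1,0}M$, $v^\alpha=y^\alpha+iy^{\alpha^*}$. $T_{\mathbb R}M$ and $T^{1,0}M$ are identified by $y=y^j\frac{\partial}{\partial x^j}\mapsto y_o=\frac12(y-iJy)=v$. $\tilde M$ denotes $T^{1,0}M\setminus\{0\}\cong T_{\mathbb R}M\setminus\{0\}$; $\mathbf J\frac{\partial}{\partial x^\alpha}=\frac{\partial}{\partial x^{\alpha^*}}$, $\mathbf J\frac{\partial}{\partial x^{\alpha^*}}=-\frac{\partial}{\partial x^\alpha}$, $\mathbf J\frac{\partial}{\partial y^\alpha}=\frac{\partial}{\partial y^{\alpha^*}}$, $\mathbf J\frac{\partial}{\partial y^{\alpha^*}}=-\frac{\partial}{\partial y^\alpha}$. A strongly convex complex Finsler metric is a function $F:T^{1,0}M\to[0,+\infty)$, positive and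 $C^\infty$ on $\tilde M$, with $F(z;\lambda v)=|\lambda|F(z;v)$ for $\lambda\in\mathbb C$, such that, viewing $F$ as a function of $(x;y)$, the matrix $g_{jk}=\frac12\frac{\partial^2F^2}{\partial y^j\partial y^k}$ is positive definite on $\tilde M$ (then $G_{\alpha\bar\beta}=\frac{\partial^2F^2}{\partial v^\alpha\partial\bar v^\beta}$ is Hermitian positive definite). Cartan connection. $\hat{\mathbb G}^k=\frac14g^{kl}\big(\frac{\partial^2F^2}{\partial x^a\partial y^l}y^a-\frac{\partial F^2}{\partial x^l}\big)$, $\hat\Gamma^k_j=\frac{\partial\hat{\mathbb G}^k}{\partial y^j}$, $\frac{\delta}{\delta x^j}=\frac{\partial}{\partial x^j}-\hat\Gamma^k_j\frac{\partial}{\partial y^k}$; $\mathcal H_{\mathbb R}=\mathrm{span}\{\frac{\delta}{\delta x^j}\}$, $\mathcal V_{\mathbb R}=\mathrm{span}\{\frac{\partial}{\partial y^j}\}$. With $\hat\Gamma^k_{j;l}=\frac{g^{ks}}2\big(\frac{\delta g_{sj}}{\delta x^l}-\frac{\delta g_{jl}}{\delta x^s}+\frac{\delta g_{ls}}{\delta x^j}\big)$ and $\hat\Gamma^k_{jl}=\frac14g^{ks}\frac{\partial^3F^2}{\partial y^j\partial y^l\partial y^s}$, the Cartan connection $\nabla$ is the linear connection on $\mathcal V_{\mathbb R}\to\tilde M$ with $\nabla_{\frac{\delta}{\delta x^l}}\frac{\partial}{\partial y^j}=\hat\Gamma^k_{j;l}\frac{\partial}{\partial y^k}$, $\nabla_{\frac{\partial}{\partial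 y^l}}\frac{\partial}{\partial y^j}=\hat\Gamma^k_{jl}\frac{\partial}{\partial y^k}$. $\nabla_X\mathbf J=0$ means $\nabla_X(\mathbf JY)=\mathbf J(\nabla_XY)$ for all sections $Y$ of $\mathcal V_{\mathbb R}$. Kähler-Berwald. With $G^{\bar\tau\alpha}G_{\beta\bar\tau}=\delta^\alpha_\beta$, set $\Gamma^\alpha_{;\mu}=G^{\bar\tau\alpha}\frac{\partial^2F^2}{\partial z^\mu\partial\bar v^\tau}$, $\delta_\mu=\frac{\partial}{\partial z^\mu}-\Gamma^\alpha_{;\mu}\frac{\partial}{\partial v^\alpha}$, $\Gamma^\alpha_{\beta;\mu}=G^{\bar\tau\alpha}\delta_\mu(G_{\beta\bar\tau})$. $F$ is Kähler-Finsler if $\Gamma^\alpha_{\beta;\mu}=\Gamma^\alpha_{\mu;\beta}$; complex Berwald if each $\Gamma^\alpha_{\beta;\mu}$ depends only on the base point $z$; Kähler-Berwald if it is both. *)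

theory Defs
  imports "HOL-Analysis.Analysis"
begin

subsection \<open>Smooth and holomorphic maps\<close>

text \<open>For an open subset of a Euclidean space, \<open>Ck_on k f S\<close> is the usual class $C^k$.\<close>

fun Ck_on :: "nat \<Rightarrow> ('a::euclidean_space \<Rightarrow> 'b::real_normed_vector) \<Rightarrow> 'a set \<Rightarrow> bool" where
  "Ck_on 0 f S \<longleftrightarrow> continuous_on S f"
| "Ck_on (Suc k) f S \<longleftrightarrow>
     (\<forall>p\<in>S. f differentiable (at p)) \<and>
     (\<forall>u. Ck_on k (\<lambda>p. frechet_derivative f (at p) u) S)"

definition C_infinity_on :: "('a::euclidean_space \<Rightarrow> 'b::real_normed_vector) \<Rightarrow> 'a set \<Rightarrow> bool" where
  "C_infinity_on f S \<longleftrightarrow> (\<forall>k. Ck_on k f S)"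

text \<open>The type \<open>complex ^ 'n\<close> carries a real Frechet derivative only, so complex linearity of the
  derivative has to be demanded explicitly.\<close>

definition holomorphic_map_on ::
    "(complex ^ 'n \<Rightarrow> complex ^ 'm) \<Rightarrow> (complex ^ 'n) set \<Rightarrow> bool" where
  "holomorphic_map_on f S \<longleftrightarrow>
     (\<forall>z\<in>S. \<exists>D. (f has_derivative D) (at z) \<and> (\<forall>c v. D (c *s v) = c *s D v))"


subsection \<open>Complex manifolds and the holomorphic tangent bundle\<close>

type_synonym ('m, 'n) chart = "'m set \<times> ('m \<Rightarrow> complex ^ 'n)"

definition chart_inv :: "('m, 'n) chart \<Rightarrow> complex ^ 'n \<Rightarrow> 'm" where
  "chart_inv c = inv_into (fst c) (snd c)"

definition transition :: "('m, 'n) chart \<Rightarrow> ('m, 'n) chart \<Rightarrow> complex ^ 'n \<Rightarrow> complex ^ 'n" where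
  "transition c d = snd d \<circ> chart_inv c"

text \<open>The atlas need not be maximal.\<close>

definition complex_manifold :: "'m topology \<Rightarrow> ('m, 'n::finite) chart set \<Rightarrow> bool" where
  "complex_manifold M A \<longleftrightarrow>
     Hausdorff_space M \<and> second_countable M \<and>
     (\<Union>c\<in>A. fst c) = topspace M \<and>
     (\<forall>c\<in>A. openin M (fst c) \<and> open (snd c ` fst c) \<and>
        homeomorphic_map (subtopology M (fst c)) (top_of_set (snd c ` fst c)) (snd c)) \<and>
     (\<forall>c\<in>A. \<forall>d\<in>A. holomorphic_map_on (transition c d) (snd c ` (fst c \<inter> fst d)))"

text \<open>A vector in $T^{1,0}_pM$ is the family of its components $v^\alpha$ in all charts around
  \<open>p\<close>, transforming by the holomorphic Jacobian of the coordinate change.  Components in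
  charts that do not contain \<open>p\<close> are set to 0, so that vectors are equal iff their components
  are.\<close>

type_synonym ('m, 'n) tvec = "('m, 'n) chart \<Rightarrow> complex ^ 'n"

definition tangent_space :: "('m, 'n::finite) chart set \<Rightarrow> 'm \<Rightarrow> ('m, 'n) tvec set" where
  "tangent_space A p = {\<xi>.
     (\<forall>c. \<not> (c \<in> A \<and> p \<in> fst c) \<longrightarrow> \<xi> c = 0) \<and>
     (\<forall>c\<in>A. \<forall>d\<in>A. p \<in> fst c \<and> p \<in> fst d \<longrightarrow>
        \<xi> d = frechet_derivative (transition c d) (at (snd c p)) (\<xi> c))}"

definition tangent_bundle ::
    "'m topology \<Rightarrow> ('m, 'n::finite) chart set \<Rightarrow> ('m \<times> ('m, 'n) tvec) set" where
  "tangent_bundle M A = (SIGMA p : topspace M. tangent_space A p)"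

definition tvec_scale :: "complex \<Rightarrow> ('m, 'n::finite) tvec \<Rightarrow> ('m, 'n) tvec" where
  "tvec_scale a \<xi> = (\<lambda>c. a *s \<xi> c)"

text \<open>The vector $v^\alpha\,\partial/\partial z^\alpha$ at \<open>p\<close>, where $z$ are the coordinates
  given by \<open>c\<close>.\<close>

definition tvec_of ::
    "('m, 'n::finite) chart set \<Rightarrow> ('m, 'n) chart \<Rightarrow> 'm \<Rightarrow> complex ^ 'n \<Rightarrow> ('m, 'n) tvec" where
  "tvec_of A c p v =
     (\<lambda>d. if d \<in> A \<and> p \<in> fst d then frechet_derivative (transition c d) (at (snd c p)) v else 0)"

type_synonym 'n coords = "(complex ^ 'n) \<times> (complex ^ 'n)"

text \<open>The function $F(z;v)$ in the local coordinates induced by \<open>c\<close>, and the coordinate range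
  of the slit bundle over \<open>c\<close>.\<close>

definition local_rep ::
    "('m, 'n::finite) chart set \<Rightarrow> ('m \<times> ('m, 'n) tvec \<Rightarrow> real) \<Rightarrow> ('m, 'n) chart \<Rightarrow>
     'n coords \<Rightarrow> real" where
  "local_rep A F c = (\<lambda>(z, v). F (chart_inv c z, tvec_of A c (chart_inv c z) v))"

definition slit_domain :: "('m, 'n::finite) chart \<Rightarrow> 'n coords set" where
  "slit_domain c = (snd c ` fst c) \<times> (- {0})"


subsection \<open>Partial derivatives\<close>

text \<open>Greek indices have type \<open>'n\<close>, Latin indices have type \<open>'n + 'n\<close>, with $\alpha$ and
  $\alpha^*$ given by \<open>Inl \<alpha>\<close> and \<open>Inr \<alpha>\<close>.  A point $(z,v)$ also stands for its real
  coordinates $(x;y)$: differentiating in $x^j$ or $y^j$ means differentiating in the direction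
  \<open>real_basis j\<close> of the first or second component.\<close>

definition real_basis :: "'n::finite + 'n \<Rightarrow> complex ^ 'n" where
  "real_basis j = (case j of Inl \<alpha> \<Rightarrow> axis \<alpha> 1 | Inr \<alpha> \<Rightarrow> axis \<alpha> \<i>)"

definition real_coord :: "complex ^ 'n \<Rightarrow> 'n + 'n \<Rightarrow> real" where
  "real_coord v j = (case j of Inl \<alpha> \<Rightarrow> Re (v $ \<alpha>) | Inr \<alpha> \<Rightarrow> Im (v $ \<alpha>))"

definition dir_deriv ::
    "'a::real_normed_vector \<Rightarrow> ('a \<Rightarrow> 'b::real_normed_vector) \<Rightarrow> 'a \<Rightarrow> 'b" where
  "dir_deriv u h p = vector_derivative (\<lambda>t. h (p + t *\<^sub>R u)) (at 0)"

definition d_x :: "'n::finite + 'n \<Rightarrow> ('n coords \<Rightarrow> 'b::real_normed_vector) \<Rightarrow>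
    'n coords \<Rightarrow> 'b" where
  "d_x j = dir_deriv (real_basis j, 0)"

definition d_y :: "'n::finite + 'n \<Rightarrow> ('n coords \<Rightarrow> 'b::real_normed_vector) \<Rightarrow>
    'n coords \<Rightarrow> 'b" where
  "d_y j = dir_deriv (0, real_basis j)"

definition d_z :: "'n::finite \<Rightarrow> ('n coords \<Rightarrow> complex) \<Rightarrow>
    'n coords \<Rightarrow> complex" where
  "d_z \<alpha> h p = (d_x (Inl \<alpha>) h p - \<i> * d_x (Inr \<alpha>) h p) / 2"

definition d_v :: "'n::finite \<Rightarrow> ('n coords \<Rightarrow> complex) \<Rightarrow>
    'n coords \<Rightarrow> complex" where
  "d_v \<alpha> h p = (d_y (Inl \<alpha>) h p - \<i> * d_y (Inr \<alpha>) h p) / 2"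

definition d_vbar :: "'n::finite \<Rightarrow> ('n coords \<Rightarrow> complex) \<Rightarrow>
    'n coords \<Rightarrow> complex" where
  "d_vbar \<alpha> h p = (d_y (Inl \<alpha>) h p + \<i> * d_y (Inr \<alpha>) h p) / 2"


subsection \<open>Strongly convex complex Finsler metrics\<close>

text \<open>From here on \<open>f\<close> denotes the local representative $F(z;v)$ in some chart.\<close>

definition g_mat :: "('n coords \<Rightarrow> real) \<Rightarrow> 'n coords \<Rightarrow>
    real ^ ('n::finite + 'n) ^ ('n + 'n)" where
  "g_mat f p = (\<chi> j k. 1/2 * d_y j (d_y k (\<lambda>q. (f q)\<^sup>2)) p)"

definition strongly_convex_complex_Finsler ::
    "'m topology \<Rightarrow> ('m, 'n::finite) chart set \<Rightarrow> ('m \<times> ('m, 'n) tvec \<Rightarrow> real) \<Rightarrow> bool" where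
  "strongly_convex_complex_Finsler M A F \<longleftrightarrow>
     (\<forall>(p, \<xi>) \<in> tangent_bundle M A.
        F (p, \<xi>) \<ge> 0 \<and>
        (\<xi> \<noteq> (\<lambda>_. 0) \<longrightarrow> F (p, \<xi>) > 0) \<and>
        (\<forall>a. F (p, tvec_scale a \<xi>) = norm a * F (p, \<xi>))) \<and>
     (\<forall>c\<in>A. C_infinity_on (local_rep A F c) (slit_domain c) \<and>
        (\<forall>p \<in> slit_domain c. \<forall>u. u \<noteq> 0 \<longrightarrow> u \<bullet> (g_mat (local_rep A F c) p *v u) > 0))"


subsection \<open>The Cartan connection\<close>

definition g_inv :: "('n coords \<Rightarrow> real) \<Rightarrow> 'n coords \<Rightarrow>
    real ^ ('n::finite + 'n) ^ ('n + 'n)" where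
  "g_inv f p = matrix_inv (g_mat f p)"

text \<open>$\hat{\mathbb G}^k$\<close>

definition spray :: "('n coords \<Rightarrow> real) \<Rightarrow> 'n::finite + 'n \<Rightarrow>
    'n coords \<Rightarrow> real" where
  "spray f k p = 1/4 * (\<Sum>l\<in>UNIV. g_inv f p $ k $ l *
     ((\<Sum>a\<in>UNIV. d_x a (d_y l (\<lambda>q. (f q)\<^sup>2)) p * real_coord (snd p) a)
      - d_x l (\<lambda>q. (f q)\<^sup>2) p))"

text \<open>$\hat\Gamma^k_j$\<close>

definition nonlin_conn :: "('n coords \<Rightarrow> real) \<Rightarrow> 'n::finite + 'n \<Rightarrow> 'n + 'n \<Rightarrow>
    'n coords \<Rightarrow> real" where
  "nonlin_conn f k j p = d_y j (spray f k) p"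

text \<open>$\delta h/\delta x^j$\<close>

definition delta_x :: "('n coords \<Rightarrow> real) \<Rightarrow> 'n::finite + 'n \<Rightarrow>
    ('n coords \<Rightarrow> real) \<Rightarrow> 'n coords \<Rightarrow> real" where
  "delta_x f j h p = d_x j h p - (\<Sum>k\<in>UNIV. nonlin_conn f k j p * d_y k h p)"

text \<open>$\hat\Gamma^k_{j;l}$\<close>

definition Cartan_h :: "('n coords \<Rightarrow> real) \<Rightarrow> 'n::finite + 'n \<Rightarrow> 'n + 'n \<Rightarrow>
    'n + 'n \<Rightarrow> 'n coords \<Rightarrow> real" where
  "Cartan_h f k j l p = (\<Sum>s\<in>UNIV. g_inv f p $ k $ s / 2 *
     (delta_x f l (\<lambda>q. g_mat f q $ s $ j) p
      - delta_x f s (\<lambda>q. g_mat f q $ j $ l) p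
      + delta_x f j (\<lambda>q. g_mat f q $ l $ s) p))"

text \<open>$\hat\Gamma^k_{jl}$\<close>

definition Cartan_v :: "('n coords \<Rightarrow> real) \<Rightarrow> 'n::finite + 'n \<Rightarrow> 'n + 'n \<Rightarrow>
    'n + 'n \<Rightarrow> 'n coords \<Rightarrow> real" where
  "Cartan_v f k j l p =
     1/4 * (\<Sum>s\<in>UNIV. g_inv f p $ k $ s * d_y j (d_y l (d_y s (\<lambda>q. (f q)\<^sup>2))) p)"

text \<open>A real tangent vector of the slit bundle at $(x;y)$ is the pair \<open>(a, b)\<close> of its components
  in $a^j\,\partial/\partial x^j + b^j\,\partial/\partial y^j$.  A local section
  $Y^k\,\partial/\partial y^k$ of $\mathcal V_{\mathbb R}$ is given by its components.\<close>

type_synonym 'n slit_tangent = "(real ^ ('n + 'n)) \<times> (real ^ ('n + 'n))"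

definition vec_apply :: "'n::finite slit_tangent \<Rightarrow> ('n coords \<Rightarrow> real) \<Rightarrow>
    'n coords \<Rightarrow> real" where
  "vec_apply X h p = (\<Sum>j\<in>UNIV. fst X $ j * d_x j h p + snd X $ j * d_y j h p)"

text \<open>$\mathcal H_{\mathbb R}$ at \<open>p\<close>: the span of
  $\delta/\delta x^j = \partial/\partial x^j - \hat\Gamma^k_j\,\partial/\partial y^k$\<close>

definition horizontal_space :: "('n coords \<Rightarrow> real) \<Rightarrow>
    'n coords \<Rightarrow> 'n::finite slit_tangent set" where
  "horizontal_space f p = span (range (\<lambda>j. (axis j 1, \<chi> k. - nonlin_conn f k j p)))"

text \<open>$\nabla_XY$ at \<open>p\<close>.  Since
  $X = a^l\,\delta/\delta x^l + (b^l + \hat\Gamma^l_i a^i)\,\partial/\partial y^l$ for \<open>X = (a, b)\<close>,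
  this is the Leibniz extension of the two formulas for $\nabla\,\partial/\partial y^j$.\<close>

definition Cartan_connection :: "('n coords \<Rightarrow> real) \<Rightarrow>
    'n coords \<Rightarrow> 'n::finite slit_tangent \<Rightarrow>
    ('n coords \<Rightarrow> real ^ ('n + 'n)) \<Rightarrow> real ^ ('n + 'n)" where
  "Cartan_connection f p X Y = (\<chi> k.
     vec_apply X (\<lambda>q. Y q $ k) p +
     (\<Sum>j\<in>UNIV. Y p $ j * (\<Sum>l\<in>UNIV.
        fst X $ l * Cartan_h f k j l p +
        (snd X $ l + (\<Sum>i\<in>UNIV. nonlin_conn f l i p * fst X $ i)) * Cartan_v f k j l p)))"

text \<open>$\mathbf J$ on components of vertical vectors:
  $\mathbf J\,\partial/\partial y^\alpha = \partial/\partial y^{\alpha^*}$ and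
  $\mathbf J\,\partial/\partial y^{\alpha^*} = -\partial/\partial y^\alpha$\<close>

definition J_vert :: "real ^ ('n::finite + 'n) \<Rightarrow> real ^ ('n + 'n)" where
  "J_vert Y = (\<chi> k. case k of Inl \<alpha> \<Rightarrow> - (Y $ Inr \<alpha>) | Inr \<alpha> \<Rightarrow> Y $ Inl \<alpha>)"

text \<open>$\nabla_X\mathbf J = 0$ for all $X \in \mathcal H_{\mathbb R}$.  As $\nabla$ is a local
  operator given on coordinate frames, the condition is imposed on smooth sections of
  $\mathcal V_{\mathbb R}$ over open subsets of the slit bundle over each chart.\<close>

definition J_horizontally_parallel ::
    "('m, 'n::finite) chart set \<Rightarrow> ('m \<times> ('m, 'n) tvec \<Rightarrow> real) \<Rightarrow> bool" where
  "J_horizontally_parallel A F \<longleftrightarrow>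
     (\<forall>c\<in>A. \<forall>W Y. open W \<and> W \<subseteq> slit_domain c \<and> C_infinity_on Y W \<longrightarrow>
        (\<forall>p\<in>W. \<forall>X \<in> horizontal_space (local_rep A F c) p.
           Cartan_connection (local_rep A F c) p X (\<lambda>q. J_vert (Y q)) =
           J_vert (Cartan_connection (local_rep A F c) p X Y)))"


subsection \<open>Kaehler-Berwald metrics\<close>

text \<open>$G_{\alpha\bar\beta}$, with row index $\alpha$\<close>

definition G_mat :: "('n coords \<Rightarrow> real) \<Rightarrow> 'n coords \<Rightarrow>
    complex ^ 'n::finite ^ 'n" where
  "G_mat f p = (\<chi> \<alpha> \<beta>. d_v \<alpha> (d_vbar \<beta> (\<lambda>q. complex_of_real ((f q)\<^sup>2))) p)"

text \<open>$G^{\bar\tau\alpha}$ is the entry in row $\tau$ and column $\alpha$, as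
  $G_{\beta\bar\tau}G^{\bar\tau\alpha} = \delta^\alpha_\beta$.\<close>

definition G_inv :: "('n coords \<Rightarrow> real) \<Rightarrow> 'n coords \<Rightarrow>
    complex ^ 'n::finite ^ 'n" where
  "G_inv f p = matrix_inv (G_mat f p)"

text \<open>$\Gamma^\alpha_{;\mu}$\<close>

definition CF_nonlin :: "('n coords \<Rightarrow> real) \<Rightarrow> 'n::finite \<Rightarrow> 'n \<Rightarrow>
    'n coords \<Rightarrow> complex" where
  "CF_nonlin f \<alpha> \<mu> p = (\<Sum>\<tau>\<in>UNIV. G_inv f p $ \<tau> $ \<alpha> *
     d_z \<mu> (d_vbar \<tau> (\<lambda>q. complex_of_real ((f q)\<^sup>2))) p)"

text \<open>$\delta_\mu h$\<close>

definition delta_z :: "('n coords \<Rightarrow> real) \<Rightarrow> 'n::finite \<Rightarrow>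
    ('n coords \<Rightarrow> complex) \<Rightarrow> 'n coords \<Rightarrow> complex" where
  "delta_z f \<mu> h p = d_z \<mu> h p - (\<Sum>\<alpha>\<in>UNIV. CF_nonlin f \<alpha> \<mu> p * d_v \<alpha> h p)"

text \<open>$\Gamma^\alpha_{\beta;\mu}$\<close>

definition CF_conn :: "('n coords \<Rightarrow> real) \<Rightarrow> 'n::finite \<Rightarrow> 'n \<Rightarrow> 'n \<Rightarrow>
    'n coords \<Rightarrow> complex" where
  "CF_conn f \<alpha> \<beta> \<mu> p =
     (\<Sum>\<tau>\<in>UNIV. G_inv f p $ \<tau> $ \<alpha> * delta_z f \<mu> (\<lambda>q. G_mat f q $ \<beta> $ \<tau>) p)"

definition Kaehler_Finsler ::
    "('m, 'n::finite) chart set \<Rightarrow> ('m \<times> ('m, 'n) tvec \<Rightarrow> real) \<Rightarrow> bool" where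
  "Kaehler_Finsler A F \<longleftrightarrow>
     (\<forall>c\<in>A. \<forall>p \<in> slit_domain c. \<forall>\<alpha> \<beta> \<mu>.
        CF_conn (local_rep A F c) \<alpha> \<beta> \<mu> p = CF_conn (local_rep A F c) \<alpha> \<mu> \<beta> p)"

definition complex_Berwald ::
    "('m, 'n::finite) chart set \<Rightarrow> ('m \<times> ('m, 'n) tvec \<Rightarrow> real) \<Rightarrow> bool" where
  "complex_Berwald A F \<longleftrightarrow>
     (\<forall>c\<in>A. \<forall>z v w. (z, v) \<in> slit_domain c \<and> (z, w) \<in> slit_domain c \<longrightarrow>
        (\<forall>\<alpha> \<beta> \<mu>. CF_conn (local_rep A F c) \<alpha> \<beta> \<mu> (z, v) = CF_conn (local_rep A F c) \<alpha> \<beta> \<mu> (z, w)))"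

definition Kaehler_Berwald ::
    "('m, 'n::finite) chart set \<Rightarrow> ('m \<times> ('m, 'n) tvec \<Rightarrow> real) \<Rightarrow> bool" where
  "Kaehler_Berwald A F \<longleftrightarrow> Kaehler_Finsler A F \<and> complex_Berwald A F"

end

theory Submission
  imports Defs "HOL-Complex_Analysis.Cauchy_Integral_Formula"
begin

text \<open>
  The statement is local, so let $L = F^2$ in a chart, write $\hat G^k$ for the spray coefficients,
  $N^k_l = \partial\hat G^k/\partial y^l$ for the nonlinear connection and $\hat\Gamma^k_{j;l}$ for the
  horizontal Cartan coefficients.

  On constant sections the condition $\nabla_X\mathbf J = 0$ says that $\hat\Gamma^k_{j;l}$ commutes with
  $\mathbf J$ in the pair $(k,j)$.  As $\hat\Gamma^k_{j;l}$ is symmetric in $j,l$ (\<open>Cartan_h_sym\<close>), it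
  does so in the pair $(k,l)$ as well, and the classical identity
  $\hat\Gamma^k_{j;l}\,y^j = N^k_l$ (\<open>Cartan_h_contract\<close>) makes the matrix $N^k_l$ complex linear
  (\<open>N_J\<close>).  But $N$ is the fibre derivative of the spray, so complex linearity is the system of
  Cauchy-Riemann equations: the complex spray $G^\alpha = \hat G^\alpha + i\hat G^{\alpha^*}$ is holomorphic
  in $v$.

  The other classical identity, $\delta L/\delta x^l = 0$ (\<open>horizontal_L\<close>), now reads
  $\partial_{z^\mu}L = (\partial_{v^\mu}G^\alpha)\,\partial_{v^\alpha}L$.  Differentiating by $\bar v^\tau$ only hits
  $L$ and gives $\partial_{z^\mu}\partial_{\bar v^\tau}L = (\partial_{v^\mu}G^\alpha)\,G_{\alpha\bar\tau}$, that is,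
  $\Gamma^\alpha_{;\mu} = \partial_{v^\mu}G^\alpha$.  Differentiating once more by $v^\beta$ gives
  $\Gamma^\alpha_{\beta;\mu} = \partial_{v^\beta}\partial_{v^\mu}G^\alpha$ (\<open>CF_conn_eq\<close>).

  This expression is symmetric in $\beta,\mu$, so $F$ is Kaehler-Finsler.  It is also holomorphic on
  the fibre without its origin and homogeneous of degree 0, because the spray has degree 2.  Such
  a function is bounded by compactness of the sphere, hence constant on every complex line that
  avoids the origin by Liouville's theorem; as $n \ge 2$ these lines connect all directions
  (\<open>fiber_constant\<close>).  So $F$ is a complex Berwald metric.
\<close>

section \<open>Smooth functions and directional derivatives\<close>

text \<open>The total function \<open>frechet_derivative\<close> has arbitrary values at points where there is no
  derivative, so the class only sees a function on the open set itself.\<close>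

lemma Ck_on_cong:
  assumes "open S" "Ck_on k f S" "\<And>p. p \<in> S \<Longrightarrow> f p = g p"
  shows "Ck_on k g S"
  using assms(2,3)
proof (induction k arbitrary: f g)
  case 0
  then show ?case by (simp cong: continuous_on_cong)
next
  case (Suc k)
  have der: "(g has_derivative frechet_derivative f (at p)) (at p)" if "p \<in> S" for p
  proof (rule has_derivative_transform_within_open[OF _ assms(1) that])
    show "(f has_derivative frechet_derivative f (at p)) (at p)"
      using Suc.prems(1) that by (simp add: frechet_derivative_works)
  qed (use Suc.prems in auto)
  show ?case
    unfolding Ck_on.simps
  proof (intro conjI ballI allI)
    fix p assume "p \<in> S"
    then show "g differentiable at p" using der differentiable_def by blast
  next
    fix u
    show "Ck_on k (\<lambda>p. frechet_derivative g (at p) u) S"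
    proof (rule Suc.IH)
      show "Ck_on k (\<lambda>p. frechet_derivative f (at p) u) S" using Suc.prems(1) by simp
      show "frechet_derivative f (at p) u = frechet_derivative g (at p) u" if "p \<in> S" for p
        using frechet_derivative_at[OF der[OF that]] by simp
    qed
  qed
qed

lemma Ck_on_Suc_imp: "Ck_on (Suc k) f S \<Longrightarrow> Ck_on k f S"
proof (induction k arbitrary: f)
  case 0
  then show ?case
    by (auto intro!: continuous_at_imp_continuous_on differentiable_imp_continuous_within)
next
  case (Suc k)
  then show ?case by (metis Ck_on.simps(2))
qed

lemma dir_deriv_eqI: "(h has_derivative h') (at p) \<Longrightarrow> dir_deriv u h p = h' u"
proof -
  assume h: "(h has_derivative h') (at p)"
  have "((\<lambda>t. h (p + t *\<^sub>R u)) has_derivative (\<lambda>t. h' (t *\<^sub>R u))) (at 0)"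
  proof (rule has_derivative_compose[of "\<lambda>t. p + t *\<^sub>R u"])
    show "((\<lambda>t. p + t *\<^sub>R u) has_derivative (\<lambda>t. t *\<^sub>R u)) (at 0)"
      by (auto intro!: derivative_eq_intros)
  qed (use h in simp)
  moreover have "h' (t *\<^sub>R u) = t *\<^sub>R h' u" for t
    using has_derivative_linear[OF h] by (simp add: linear_cmul)
  ultimately have "((\<lambda>t. h (p + t *\<^sub>R u)) has_vector_derivative h' u) (at 0)"
    by (simp add: has_vector_derivative_def)
  then show ?thesis unfolding dir_deriv_def by (rule vector_derivative_at)
qed

lemma dir_deriv_frechet:
  "h differentiable (at p) \<Longrightarrow> dir_deriv u h p = frechet_derivative h (at p) u"
  by (rule dir_deriv_eqI) (simp add: frechet_derivative_works)

lemma smooth_differentiable: "C_infinity_on h S \<Longrightarrow> p \<in> S \<Longrightarrow> h differentiable (at p)"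
  unfolding C_infinity_on_def by (metis Ck_on.simps(2))

lemma smooth_continuous_on: "C_infinity_on h S \<Longrightarrow> continuous_on S h"
  unfolding C_infinity_on_def by (metis Ck_on.simps(1))

lemma smooth_has_derivative:
  assumes "C_infinity_on h S" "p \<in> S"
  shows "(h has_derivative (\<lambda>u. dir_deriv u h p)) (at p)"
  using smooth_differentiable[OF assms] by (simp add: dir_deriv_frechet frechet_derivative_works)

lemma smooth_dir_deriv:
  assumes "open S" "C_infinity_on h S"
  shows "C_infinity_on (dir_deriv u h) S"
  unfolding C_infinity_on_def
proof
  fix k
  have "Ck_on k (\<lambda>p. frechet_derivative h (at p) u) S"
    using assms(2) unfolding C_infinity_on_def by (metis Ck_on.simps(2))
  then show "Ck_on k (dir_deriv u h) S"
    by (rule Ck_on_cong[OF assms(1)]) (simp add: dir_deriv_frechet smooth_differentiable[OF assms(2)])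
qed

lemma smooth_cong:
  assumes "open S" "C_infinity_on f S" "\<And>p. p \<in> S \<Longrightarrow> f p = g p"
  shows "C_infinity_on g S"
  using assms Ck_on_cong unfolding C_infinity_on_def by blast

lemma Ck_on_const: "Ck_on k (\<lambda>_. c) S"
  by (induction k arbitrary: c) auto

lemma smooth_const: "C_infinity_on (\<lambda>_. c) S"
  by (simp add: C_infinity_on_def Ck_on_const)

lemma smooth_linear:
  assumes "bounded_linear h"
  shows "C_infinity_on h S"
  unfolding C_infinity_on_def
proof
  fix k
  have d: "(h has_derivative h) (at p)" for p
    using assms by (rule bounded_linear_imp_has_derivative)
  have "frechet_derivative h (at p) = h" for p
    using frechet_derivative_at[OF d] by simp
  then show "Ck_on k h S"
    using d assms by (cases k) (auto simp: Ck_on_const differentiable_def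
      intro: linear_continuous_on)
qed

text \<open>All closure properties are proved one order at a time: the derivative of the compound
  function is an expression of the same kind in the functions and their derivatives.\<close>

lemma Ck_on_add:
  assumes "open S"
  shows "Ck_on k f S \<Longrightarrow> Ck_on k g S \<Longrightarrow> Ck_on k (\<lambda>p. f p + g p) S"
proof (induction k arbitrary: f g)
  case 0
  then show ?case by (simp add: continuous_on_add)
next
  case (Suc k)
  show ?case unfolding Ck_on.simps
  proof (intro conjI ballI allI)
    fix p assume "p \<in> S"
    then show "(\<lambda>p. f p + g p) differentiable at p" using Suc.prems by simp
  next
    fix u
    show "Ck_on k (\<lambda>p. frechet_derivative (\<lambda>p. f p + g p) (at p) u) S"
    proof (rule Ck_on_cong[OF assms Suc.IH])
      fix p assume "p \<in> S"
      then have "((\<lambda>p. f p + g p) has_derivative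
          (\<lambda>u. frechet_derivative f (at p) u + frechet_derivative g (at p) u)) (at p)"
        using Suc.prems by (intro has_derivative_add) (simp_all add: frechet_derivative_works)
      from frechet_derivative_at[OF this]
      show "frechet_derivative f (at p) u + frechet_derivative g (at p) u =
          frechet_derivative (\<lambda>p. f p + g p) (at p) u" by metis
    qed (use Suc.prems in auto)
  qed
qed

lemma Ck_on_mult:
  fixes f g :: "'a::euclidean_space \<Rightarrow> 'b::real_normed_algebra"
  assumes "open S"
  shows "Ck_on k f S \<Longrightarrow> Ck_on k g S \<Longrightarrow> Ck_on k (\<lambda>p. f p * g p) S"
proof (induction k arbitrary: f g)
  case 0
  then show ?case by (simp add: continuous_on_mult)
next
  case (Suc k)
  show ?case unfolding Ck_on.simps
  proof (intro conjI ballI allI)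
    fix p assume "p \<in> S"
    then show "(\<lambda>p. f p * g p) differentiable at p" using Suc.prems by simp
  next
    fix u
    show "Ck_on k (\<lambda>p. frechet_derivative (\<lambda>p. f p * g p) (at p) u) S"
    proof (rule Ck_on_cong[OF assms Ck_on_add[OF assms Suc.IH Suc.IH]])
      fix p assume "p \<in> S"
      then have "((\<lambda>p. f p * g p) has_derivative
          (\<lambda>u. f p * frechet_derivative g (at p) u + frechet_derivative f (at p) u * g p)) (at p)"
        using Suc.prems by (intro has_derivative_mult) (simp_all add: frechet_derivative_works)
      from frechet_derivative_at[OF this]
      show "f p * frechet_derivative g (at p) u + frechet_derivative f (at p) u * g p =
          frechet_derivative (\<lambda>p. f p * g p) (at p) u" by metis
    qed (use Suc.prems Ck_on_Suc_imp in \<open>auto simp del: Ck_on.simps(1)\<close>)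
  qed
qed

lemma Ck_on_inverse:
  fixes f :: "'a::euclidean_space \<Rightarrow> 'b::real_normed_div_algebra"
  assumes "open S" "\<And>p. p \<in> S \<Longrightarrow> f p \<noteq> 0"
  shows "Ck_on k f S \<Longrightarrow> Ck_on k (\<lambda>p. inverse (f p)) S"
proof (induction k)
  case 0
  then show ?case using assms by (simp add: continuous_on_inverse)
next
  case (Suc k)
  have inv: "Ck_on k (\<lambda>p. inverse (f p)) S"
    using Suc Ck_on_Suc_imp by blast
  have der: "((\<lambda>p. inverse (f p)) has_derivative
       (\<lambda>u. - (inverse (f p) * frechet_derivative f (at p) u * inverse (f p)))) (at p)"
    if "p \<in> S" for p
    using Suc.prems that assms(2) by (intro Deriv.has_derivative_inverse) (simp_all add: frechet_derivative_works)
  show ?case unfolding Ck_on.simps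
  proof (intro conjI ballI allI)
    fix p assume "p \<in> S"
    then show "(\<lambda>p. inverse (f p)) differentiable at p"
      using der differentiable_def by blast
  next
    fix u
    show "Ck_on k (\<lambda>p. frechet_derivative (\<lambda>p. inverse (f p)) (at p) u) S"
    proof (rule Ck_on_cong[OF assms(1)])
      show "Ck_on k (\<lambda>p. (- 1) * (inverse (f p) * frechet_derivative f (at p) u * inverse (f p))) S"
        using Suc.prems by (intro Ck_on_mult[OF assms(1)] inv Ck_on_const) simp
      fix p assume "p \<in> S"
      from frechet_derivative_at[OF der[OF this]]
      show "- 1 * (inverse (f p) * frechet_derivative f (at p) u * inverse (f p)) =
          frechet_derivative (\<lambda>p. inverse (f p)) (at p) u" by (metis mult_minus1)
    qed
  qed
qed

lemma smooth_add:
  "open S \<Longrightarrow> C_infinity_on f S \<Longrightarrow> C_infinity_on g S \<Longrightarrow> C_infinity_on (\<lambda>p. f p + g p) S"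
  by (simp add: C_infinity_on_def Ck_on_add)

lemma smooth_mult:
  fixes f g :: "'a::euclidean_space \<Rightarrow> 'b::real_normed_algebra"
  shows "open S \<Longrightarrow> C_infinity_on f S \<Longrightarrow> C_infinity_on g S \<Longrightarrow> C_infinity_on (\<lambda>p. f p * g p) S"
  by (simp add: C_infinity_on_def Ck_on_mult)

lemma smooth_divide:
  fixes f g :: "'a::euclidean_space \<Rightarrow> 'b::real_normed_field"
  shows "open S \<Longrightarrow> C_infinity_on f S \<Longrightarrow> C_infinity_on g S \<Longrightarrow> (\<And>p. p \<in> S \<Longrightarrow> g p \<noteq> 0) \<Longrightarrow>
    C_infinity_on (\<lambda>p. f p / g p) S"
  by (simp add: C_infinity_on_def divide_inverse Ck_on_mult Ck_on_inverse)

lemma smooth_sum: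
  "open S \<Longrightarrow> (\<And>i. i \<in> I \<Longrightarrow> C_infinity_on (f i) S) \<Longrightarrow> C_infinity_on (\<lambda>p. \<Sum>i\<in>I. f i p) S"
  by (induction I rule: infinite_finite_induct) (auto simp: smooth_const smooth_add)

lemma smooth_prod:
  fixes f :: "'i \<Rightarrow> 'a::euclidean_space \<Rightarrow> 'b::{real_normed_algebra_1,comm_ring_1}"
  shows "open S \<Longrightarrow> (\<And>i. i \<in> I \<Longrightarrow> C_infinity_on (f i) S) \<Longrightarrow> C_infinity_on (\<lambda>p. \<Prod>i\<in>I. f i p) S"
  by (induction I rule: infinite_finite_induct) (auto simp: smooth_const smooth_mult)

lemma smooth_bounded_linear:
  assumes S: "open S" and l: "bounded_linear l" and h: "C_infinity_on h S"
  shows "C_infinity_on (\<lambda>q. l (h q)) S"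
proof -
  have "Ck_on k h S \<Longrightarrow> Ck_on k (\<lambda>q. l (h q)) S" for k
  proof (induction k arbitrary: h)
    case 0
    then show ?case using l by (simp add: bounded_linear.continuous_on)
  next
    case (Suc k)
    have der: "((\<lambda>q. l (h q)) has_derivative (\<lambda>u. l (frechet_derivative h (at p) u))) (at p)"
      if "p \<in> S" for p
      using Suc.prems that
      by (intro bounded_linear.has_derivative[OF l]) (simp_all add: frechet_derivative_works)
    show ?case unfolding Ck_on.simps
    proof (intro conjI ballI allI)
      fix p assume "p \<in> S"
      then show "(\<lambda>q. l (h q)) differentiable at p"
        using der differentiable_def by blast
    next
      fix u
      show "Ck_on k (\<lambda>p. frechet_derivative (\<lambda>q. l (h q)) (at p) u) S"
      proof (rule Ck_on_cong[OF S Suc.IH])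
        fix p assume "p \<in> S"
        from frechet_derivative_at[OF der[OF this]]
        show "l (frechet_derivative h (at p) u) =
          frechet_derivative (\<lambda>q. l (h q)) (at p) u" by metis
      qed (use Suc.prems in simp)
    qed
  qed
  then show ?thesis using h by (simp add: C_infinity_on_def)
qed

lemma smooth_diff:
  assumes "open S" "C_infinity_on f S" "C_infinity_on g S"
  shows "C_infinity_on (\<lambda>p. f p - g p) S"
  using smooth_add[OF assms(1,2) smooth_bounded_linear[OF assms(1) bounded_linear_minus[OF bounded_linear_ident] assms(3)]]
  by simp

lemma dir_deriv_const [simp]: "dir_deriv u (\<lambda>_. c) p = 0"
  by (rule dir_deriv_eqI[of _ "\<lambda>_. 0"]) simp

lemma dir_deriv_add:
  assumes "C_infinity_on f S" "C_infinity_on g S" "p \<in> S"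
  shows "dir_deriv u (\<lambda>q. f q + g q) p = dir_deriv u f p + dir_deriv u g p"
  using assms by (intro dir_deriv_eqI) (auto intro: has_derivative_add smooth_has_derivative)

lemma dir_deriv_diff:
  assumes "C_infinity_on f S" "C_infinity_on g S" "p \<in> S"
  shows "dir_deriv u (\<lambda>q. f q - g q) p = dir_deriv u f p - dir_deriv u g p"
  using assms by (intro dir_deriv_eqI) (auto intro: has_derivative_diff smooth_has_derivative)

lemma dir_deriv_sum:
  assumes "\<And>i. i \<in> I \<Longrightarrow> C_infinity_on (f i) S" "p \<in> S"
  shows "dir_deriv u (\<lambda>q. \<Sum>i\<in>I. f i q) p = (\<Sum>i\<in>I. dir_deriv u (f i) p)"
  using assms by (intro dir_deriv_eqI) (auto intro!: has_derivative_sum smooth_has_derivative)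

lemma dir_deriv_mult:
  fixes f g :: "'a::euclidean_space \<Rightarrow> 'b::real_normed_algebra"
  assumes "C_infinity_on f S" "C_infinity_on g S" "p \<in> S"
  shows "dir_deriv u (\<lambda>q. f q * g q) p = f p * dir_deriv u g p + dir_deriv u f p * g p"
  using assms by (intro dir_deriv_eqI) (auto intro: has_derivative_mult smooth_has_derivative)

lemma dir_deriv_bounded_linear:
  assumes "bounded_linear l" "C_infinity_on f S" "p \<in> S"
  shows "dir_deriv u (\<lambda>q. l (f q)) p = l (dir_deriv u f p)"
  using assms
  by (intro dir_deriv_eqI) (auto intro: bounded_linear.has_derivative smooth_has_derivative)

lemma dir_deriv_linear:
  assumes "bounded_linear h"
  shows "dir_deriv u h p = h u"
  by (rule dir_deriv_eqI, rule bounded_linear_imp_has_derivative, rule assms)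

lemma dir_deriv_cong:
  assumes "open S" "p \<in> S" "\<And>q. q \<in> S \<Longrightarrow> f q = g q" "C_infinity_on f S"
  shows "dir_deriv u f p = dir_deriv u g p"
  using has_derivative_transform_within_open[OF smooth_has_derivative[OF assms(4,2)] assms(1,2)]
    assms(3) by (metis dir_deriv_eqI)

lemma dir_deriv_sum_direction:
  assumes "C_infinity_on h S" "p \<in> S"
  shows "dir_deriv (\<Sum>i\<in>I. c i *\<^sub>R u i) h p = (\<Sum>i\<in>I. c i *\<^sub>R dir_deriv (u i) h p)"
proof -
  interpret linear "\<lambda>u. dir_deriv u h p"
    by (rule has_derivative_linear[OF smooth_has_derivative[OF assms]])
  show ?thesis by (simp add: sum scale)
qed

text \<open>Two applications of the mean value theorem, first in the direction \<open>u\<close> to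
  $s \mapsto h(p+su+tw)-h(p+su)$ and then in the direction \<open>w\<close>.  The left-hand side is symmetric
  in \<open>u\<close> and \<open>w\<close>, which is what makes the mixed derivatives agree.\<close>

lemma second_difference_mean_value:
  fixes h :: "'a::euclidean_space \<Rightarrow> real"
  assumes S: "open S" and h: "C_infinity_on h S" and t: "0 < t"
    and box: "\<And>a b. a \<in> {0..t} \<Longrightarrow> b \<in> {0..t} \<Longrightarrow> p + a *\<^sub>R u + b *\<^sub>R w \<in> S"
  obtains a b where "a \<in> {0..t}" "b \<in> {0..t}"
    "h (p + t *\<^sub>R u + t *\<^sub>R w) - h (p + t *\<^sub>R u) - h (p + t *\<^sub>R w) + h p =
      t\<^sup>2 * dir_deriv w (dir_deriv u h) (p + a *\<^sub>R u + b *\<^sub>R w)"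
proof -
  define \<phi> where "\<phi> = (\<lambda>s. h (p + s *\<^sub>R u + t *\<^sub>R w) - h (p + s *\<^sub>R u))"
  have curve: "((\<lambda>s. k (q + s *\<^sub>R z)) has_real_derivative dir_deriv z k (q + s *\<^sub>R z)) (at s)"
    if "C_infinity_on k S" "q + s *\<^sub>R z \<in> S" for k :: "'a \<Rightarrow> real" and q z s
  proof -
    have "((\<lambda>s. k (q + s *\<^sub>R z)) has_derivative (\<lambda>r. dir_deriv (r *\<^sub>R z) k (q + s *\<^sub>R z))) (at s)"
    proof (rule has_derivative_compose[of "\<lambda>s. q + s *\<^sub>R z"])
      show "((\<lambda>s. q + s *\<^sub>R z) has_derivative (\<lambda>r. r *\<^sub>R z)) (at s)"
        by (auto intro!: derivative_eq_intros)
    qed (use that in \<open>auto intro: smooth_has_derivative\<close>)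
    moreover have "dir_deriv (r *\<^sub>R z) k (q + s *\<^sub>R z) = dir_deriv z k (q + s *\<^sub>R z) * r" for r
      using dir_deriv_sum_direction[OF that, of "\<lambda>_. r" "\<lambda>_. z" "{()}"] by simp
    ultimately show ?thesis by (simp add: has_field_derivative_def)
  qed
  have "\<exists>a. 0 < a \<and> a < t \<and> \<phi> t - \<phi> 0 =
      (t - 0) * (dir_deriv u h (p + t *\<^sub>R w + a *\<^sub>R u) - dir_deriv u h (p + a *\<^sub>R u))"
  proof (rule MVT2[OF t])
    fix s assume s: "0 \<le> s" "s \<le> t"
    have "p + t *\<^sub>R w + s *\<^sub>R u \<in> S" "p + s *\<^sub>R u \<in> S"
      using box[of s t] box[of s 0] s t by (simp_all add: algebra_simps)
    then show "(\<phi> has_real_derivative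
        dir_deriv u h (p + t *\<^sub>R w + s *\<^sub>R u) - dir_deriv u h (p + s *\<^sub>R u)) (at s)"
      using DERIV_diff[OF curve[OF h, of "p + t *\<^sub>R w" s u] curve[OF h, of p s u]]
      by (simp add: \<phi>_def algebra_simps)
  qed
  then obtain a where a: "0 < a" "a < t"
    and eq1: "\<phi> t - \<phi> 0 = t * (dir_deriv u h (p + t *\<^sub>R w + a *\<^sub>R u) - dir_deriv u h (p + a *\<^sub>R u))"
    by auto
  have "\<exists>b. 0 < b \<and> b < t \<and>
      dir_deriv u h (p + a *\<^sub>R u + t *\<^sub>R w) - dir_deriv u h (p + a *\<^sub>R u + 0 *\<^sub>R w) =
      (t - 0) * dir_deriv w (dir_deriv u h) (p + a *\<^sub>R u + b *\<^sub>R w)"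
  proof (rule MVT2[OF t])
    fix s assume s: "0 \<le> s" "s \<le> t"
    show "((\<lambda>s. dir_deriv u h (p + a *\<^sub>R u + s *\<^sub>R w)) has_real_derivative
        dir_deriv w (dir_deriv u h) (p + a *\<^sub>R u + s *\<^sub>R w)) (at s)"
      using a s box[of a s] by (intro curve smooth_dir_deriv S h) auto
  qed
  then obtain b where b: "0 < b" "b < t"
    and eq2: "dir_deriv u h (p + a *\<^sub>R u + t *\<^sub>R w) - dir_deriv u h (p + a *\<^sub>R u) =
      t * dir_deriv w (dir_deriv u h) (p + a *\<^sub>R u + b *\<^sub>R w)"
    by auto
  have "h (p + t *\<^sub>R u + t *\<^sub>R w) - h (p + t *\<^sub>R u) - h (p + t *\<^sub>R w) + h p = \<phi> t - \<phi> 0"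
    by (simp add: \<phi>_def)
  also have "\<dots> = t * (t * dir_deriv w (dir_deriv u h) (p + a *\<^sub>R u + b *\<^sub>R w))"
    using eq1 eq2 by (simp add: algebra_simps)
  finally show thesis
    using a b by (intro that[of a b]) (auto simp: power2_eq_square)
qed

text \<open>Schwarz's theorem: on arbitrarily small squares both mixed derivatives take the common value
  of the second difference quotient, and both are continuous.\<close>

lemma dir_deriv_commute_real:
  fixes h :: "'a::euclidean_space \<Rightarrow> real"
  assumes S: "open S" and h: "C_infinity_on h S" and p: "p \<in> S"
  shows "dir_deriv u (dir_deriv w h) p = dir_deriv w (dir_deriv u h) p"
proof -
  let ?A = "dir_deriv u (dir_deriv w h)" and ?B = "dir_deriv w (dir_deriv u h)"
  have "\<bar>?A p - ?B p\<bar> \<le> e" if "e > 0" for e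
  proof -
    have cont: "continuous (at p) k" if "C_infinity_on k S" for k :: "'a \<Rightarrow> real"
      using smooth_differentiable[OF that p] by (rule differentiable_imp_continuous_within)
    have contA: "continuous (at p) ?A" and contB: "continuous (at p) ?B"
      by (intro cont smooth_dir_deriv S h)+
    obtain d0 where d0: "d0 > 0" "ball p d0 \<subseteq> S"
      using S p openE by blast
    obtain dA where dA: "dA > 0" "\<And>q. dist q p < dA \<Longrightarrow> \<bar>?A q - ?A p\<bar> < e / 2"
      using contA \<open>e > 0\<close> unfolding continuous_at_eps_delta dist_real_def
      by (metis half_gt_zero)
    obtain dB where dB: "dB > 0" "\<And>q. dist q p < dB \<Longrightarrow> \<bar>?B q - ?B p\<bar> < e / 2"
      using contB \<open>e > 0\<close> unfolding continuous_at_eps_delta dist_real_def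
      by (metis half_gt_zero)
    define d where "d = min d0 (min dA dB)"
    have d: "d > 0" using d0 dA dB by (simp add: d_def)
    \<comment> \<open>a square of side \<open>t\<close> stays within distance \<open>d\<close> of its corner \<open>p\<close>\<close>
    define t where "t = d / (2 * (norm u + norm w + 1))"
    have pos: "norm u + norm w + 1 > 0" using norm_ge_zero[of u] norm_ge_zero[of w] by linarith
    have t: "t > 0" using d pos by (simp add: t_def)
    have close: "dist (p + a *\<^sub>R u + b *\<^sub>R w) p < d"
      if "a \<in> {0..t}" "b \<in> {0..t}" for a b
    proof -
      have "norm (a *\<^sub>R u + b *\<^sub>R w) \<le> norm (a *\<^sub>R u) + norm (b *\<^sub>R w)" by (rule norm_triangle_ineq)
      also have "\<dots> \<le> t * norm u + t * norm w"
        using that by (intro add_mono) (auto intro: mult_right_mono)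
      also have "\<dots> \<le> t * (norm u + norm w + 1)"
        using t by (simp add: algebra_simps)
      also have "\<dots> = d / 2" using pos by (simp add: t_def field_simps)
      finally show ?thesis using d by (simp add: dist_norm algebra_simps)
    qed
    have box: "p + a *\<^sub>R u + b *\<^sub>R w \<in> S" if "a \<in> {0..t}" "b \<in> {0..t}" for a b
      using close[OF that] d0 by (auto simp: d_def dist_commute)
    have box': "p + a *\<^sub>R w + b *\<^sub>R u \<in> S" if "a \<in> {0..t}" "b \<in> {0..t}" for a b
      using box[of b a] that by (simp add: algebra_simps)
    obtain a b where ab: "a \<in> {0..t}" "b \<in> {0..t}"
      and e1: "h (p + t *\<^sub>R u + t *\<^sub>R w) - h (p + t *\<^sub>R u) - h (p + t *\<^sub>R w) + h p =
      t\<^sup>2 * ?B (p + a *\<^sub>R u + b *\<^sub>R w)"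
      using second_difference_mean_value[OF S h t box] by blast
    obtain a' b' where ab': "a' \<in> {0..t}" "b' \<in> {0..t}"
      and e2: "h (p + t *\<^sub>R w + t *\<^sub>R u) - h (p + t *\<^sub>R w) - h (p + t *\<^sub>R u) + h p =
      t\<^sup>2 * ?A (p + a' *\<^sub>R w + b' *\<^sub>R u)"
      using second_difference_mean_value[OF S h t box'] by blast
    have "t\<^sup>2 * ?B (p + a *\<^sub>R u + b *\<^sub>R w) = t\<^sup>2 * ?A (p + a' *\<^sub>R w + b' *\<^sub>R u)"
      using e1 e2 by (simp add: algebra_simps)
    then have "?B (p + a *\<^sub>R u + b *\<^sub>R w) = ?A (p + b' *\<^sub>R u + a' *\<^sub>R w)"
      using t by (simp add: algebra_simps)
    moreover have "\<bar>?B (p + a *\<^sub>R u + b *\<^sub>R w) - ?B p\<bar> < e / 2"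
      using dB(2) close[OF ab] by (simp add: d_def)
    moreover have "\<bar>?A (p + b' *\<^sub>R u + a' *\<^sub>R w) - ?A p\<bar> < e / 2"
      using dA(2) close[OF ab'(2,1)] by (simp add: d_def)
    ultimately show ?thesis by linarith
  qed
  then show ?thesis
    by (metis abs_le_zero_iff eq_iff_diff_eq_0 field_le_epsilon add_0)
qed

lemma dir_deriv_commute:
  fixes h :: "'a::euclidean_space \<Rightarrow> 'b::euclidean_space"
  assumes S: "open S" and h: "C_infinity_on h S" and p: "p \<in> S"
  shows "dir_deriv u (dir_deriv w h) p = dir_deriv w (dir_deriv u h) p"
proof (rule euclidean_eqI)
  fix b :: 'b assume "b \<in> Basis"
  have l: "bounded_linear (\<lambda>x::'b. x \<bullet> b)" by (rule bounded_linear_inner_left)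
  have swap: "dir_deriv u (dir_deriv w h) p \<bullet> b = dir_deriv u (dir_deriv w (\<lambda>q. h q \<bullet> b)) p" for u w
  proof -
    have "dir_deriv u (dir_deriv w h) p \<bullet> b = dir_deriv u (\<lambda>q. dir_deriv w h q \<bullet> b) p"
      by (rule dir_deriv_bounded_linear[OF l smooth_dir_deriv[OF S h] p, symmetric])
    also have "\<dots> = dir_deriv u (dir_deriv w (\<lambda>q. h q \<bullet> b)) p"
      by (intro dir_deriv_cong[OF S p] smooth_bounded_linear[OF S l] smooth_dir_deriv[OF S] h)
        (simp add: dir_deriv_bounded_linear[OF l h])
    finally show ?thesis .
  qed
  show "dir_deriv u (dir_deriv w h) p \<bullet> b = dir_deriv w (dir_deriv u h) p \<bullet> b"
    unfolding swap by (intro dir_deriv_commute_real[OF S] smooth_bounded_linear[OF S l h] p)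
qed

section \<open>The Cartan connection of a strongly convex Finsler metric in coordinates\<close>

lemma real_coord_basis: "real_coord (real_basis j) i = (if i = j then 1 else 0)"
  by (auto simp: real_coord_def real_basis_def axis_def split: sum.splits)

lemma sum_UNIV_Plus:
  "(\<Sum>j\<in>(UNIV::('n::finite + 'n) set). h j) = (\<Sum>\<alpha>\<in>UNIV. h (Inl \<alpha>)) + (\<Sum>\<alpha>\<in>UNIV. h (Inr \<alpha>))"
  for h :: "_ \<Rightarrow> 'b::comm_monoid_add"
proof -
  have "(\<Sum>j\<in>(UNIV::('n + 'n) set). h j) = (\<Sum>j\<in>UNIV <+> UNIV. h j)" by simp
  also have "\<dots> = (\<Sum>\<alpha>\<in>UNIV. h (Inl \<alpha>)) + (\<Sum>\<alpha>\<in>UNIV. h (Inr \<alpha>))"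
    by (subst sum.Plus) auto
  finally show ?thesis .
qed

lemma real_basis_expansion: "(\<Sum>j\<in>UNIV. real_coord v j *\<^sub>R real_basis j) = v"
proof -
  have *: "(\<Sum>\<alpha>\<in>UNIV. Re (v $ \<alpha>) *\<^sub>R axis \<alpha> (1::complex) $ i) = of_real (Re (v $ i))"
    "(\<Sum>\<alpha>\<in>UNIV. Im (v $ \<alpha>) *\<^sub>R axis \<alpha> \<i> $ i) = Im (v $ i) *\<^sub>R \<i>" for i
    by (simp_all add: axis_def scaleR_conv_of_real mult_delta_right)
  show ?thesis
    by (simp add: vec_eq_iff sum_UNIV_Plus real_coord_def real_basis_def *)
       (simp add: complex_eq_iff)
qed

lemma bounded_linear_real_coord:
  "bounded_linear (\<lambda>q::'b::real_normed_vector \<times> (complex ^ 'n::finite). real_coord (snd q) a)"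
proof (cases a)
  case (Inl \<alpha>)
  show ?thesis unfolding Inl real_coord_def sum.case
    by (intro bounded_linear_compose[OF bounded_linear_Re]
        bounded_linear_compose[OF bounded_linear_vec_nth] bounded_linear_snd)
next
  case (Inr \<alpha>)
  show ?thesis unfolding Inr real_coord_def sum.case
    by (intro bounded_linear_compose[OF bounded_linear_Im]
        bounded_linear_compose[OF bounded_linear_vec_nth] bounded_linear_snd)
qed

lemma invertible_matrix_inv:
  fixes A :: "'a::semiring_1 ^ 'n ^ 'm"
  assumes "invertible A"
  shows "A ** matrix_inv A = mat 1" "matrix_inv A ** A = mat 1"
  using someI_ex[OF assms[unfolded invertible_def]] by (simp_all add: matrix_inv_def)

text \<open>The local computations take place over an open set \<open>U\<close> of coordinates and are separated
  from the manifold, to which only the last section returns.\<close>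

locale Finsler_rep =
  fixes U :: "(complex ^ 'n::finite) set" and f :: "'n coords \<Rightarrow> real"
  assumes open_U: "open U"
    and smooth_f: "C_infinity_on f (U \<times> (- {0}))"
    and homogeneous: "\<And>z v t. z \<in> U \<Longrightarrow> v \<noteq> 0 \<Longrightarrow> t > 0 \<Longrightarrow> f (z, t *\<^sub>R v) = t * f (z, v)"
    and g_pos: "\<And>p u. p \<in> U \<times> (- {0}) \<Longrightarrow> u \<noteq> 0 \<Longrightarrow> u \<bullet> (g_mat f p *v u) > 0"
begin

abbreviation "S \<equiv> U \<times> (- {0 :: complex ^ 'n})"
abbreviation "L \<equiv> \<lambda>q. (f q)\<^sup>2"
abbreviation "y \<equiv> \<lambda>j (q::'n coords). real_coord (snd q) j"
abbreviation "N \<equiv> nonlin_conn f"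
abbreviation "G \<equiv> spray f"

lemma open_S: "open S"
  using open_U by (intro open_Times) auto

lemma smooth_d_x: "C_infinity_on h S \<Longrightarrow> C_infinity_on (d_x j h) S"
  unfolding d_x_def by (rule smooth_dir_deriv[OF open_S])

lemma smooth_d_y: "C_infinity_on h S \<Longrightarrow> C_infinity_on (d_y j h) S"
  unfolding d_y_def by (rule smooth_dir_deriv[OF open_S])

lemma smooth_L: "C_infinity_on L S"
  using smooth_mult[OF open_S smooth_f smooth_f] by (simp add: power2_eq_square)

lemma smooth_y: "C_infinity_on (y j) S"
  by (rule smooth_linear[OF bounded_linear_real_coord])

lemmas smooth_rules = smooth_d_x smooth_d_y smooth_L smooth_y smooth_const smooth_add[OF open_S]
  smooth_diff[OF open_S] smooth_mult[OF open_S] smooth_sum[OF open_S] smooth_prod[OF open_S]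

lemma d_x_y: "d_x i (y j) p = 0"
  unfolding d_x_def by (subst dir_deriv_linear[OF bounded_linear_real_coord])
    (simp add: real_coord_def split: sum.splits)

lemma d_y_y: "d_y i (y j) p = (if j = i then 1 else 0)"
  unfolding d_y_def by (subst dir_deriv_linear[OF bounded_linear_real_coord])
    (simp add: real_coord_basis)

lemma d_y_d_y:
  fixes h :: "'n coords \<Rightarrow> 'b::euclidean_space"
  shows "C_infinity_on h S \<Longrightarrow> p \<in> S \<Longrightarrow> d_y i (d_y j h) p = d_y j (d_y i h) p"
  unfolding d_y_def by (rule dir_deriv_commute[OF open_S])

lemma d_y_d_x:
  fixes h :: "'n coords \<Rightarrow> 'b::euclidean_space"
  shows "C_infinity_on h S \<Longrightarrow> p \<in> S \<Longrightarrow> d_y i (d_x j h) p = d_x j (d_y i h) p"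
  unfolding d_y_def d_x_def by (rule dir_deriv_commute[OF open_S])

lemma d_y_cong:
  assumes "p \<in> S" "\<And>q. q \<in> S \<Longrightarrow> h q = k q" "C_infinity_on h S"
  shows "d_y i h p = d_y i k p"
  unfolding d_y_def by (rule dir_deriv_cong[OF open_S assms])

lemma d_x_cong:
  assumes "p \<in> S" "\<And>q. q \<in> S \<Longrightarrow> h q = k q" "C_infinity_on h S"
  shows "d_x i h p = d_x i k p"
  unfolding d_x_def by (rule dir_deriv_cong[OF open_S assms])

lemmas d_y_rules =
  dir_deriv_sum[where S=S and u="(0, real_basis i)" for i, folded d_y_def]
  dir_deriv_diff[where S=S and u="(0, real_basis i)" for i, folded d_y_def]
  dir_deriv_add[where S=S and u="(0, real_basis i)" for i, folded d_y_def]
  dir_deriv_mult[where S=S and u="(0, real_basis i)" for i, folded d_y_def]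

lemmas d_x_rules =
  dir_deriv_sum[where S=S and u="(real_basis i, 0)" for i, folded d_x_def]
  dir_deriv_diff[where S=S and u="(real_basis i, 0)" for i, folded d_x_def]
  dir_deriv_add[where S=S and u="(real_basis i, 0)" for i, folded d_x_def]
  dir_deriv_mult[where S=S and u="(real_basis i, 0)" for i, folded d_x_def]

lemma fiber_derivative:
  assumes "C_infinity_on h S" "p \<in> S"
  shows "dir_deriv (0, w) h p = (\<Sum>j\<in>UNIV. real_coord w j *\<^sub>R d_y j h p)"
proof -
  have "(0, w) = (\<Sum>j\<in>UNIV. real_coord w j *\<^sub>R (0::complex^'n, real_basis j))"
    by (simp add: prod_eq_iff fst_sum snd_sum real_basis_expansion)
  then show ?thesis
    unfolding d_y_def using dir_deriv_sum_direction[OF assms] by metis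
qed

text \<open>Homogeneity is encoded by Euler's identity because this form passes to derivatives by
  differentiating the identity: fibre derivatives lower the degree by one and base derivatives
  keep it.\<close>

definition fiber_homogeneous :: "real \<Rightarrow> ('n coords \<Rightarrow> 'b::real_normed_vector) \<Rightarrow> bool" where
  "fiber_homogeneous m h \<longleftrightarrow> (\<forall>p\<in>S. (\<Sum>j\<in>UNIV. y j p *\<^sub>R d_y j h p) = m *\<^sub>R h p)"

lemma fiber_homogeneousD:
  "fiber_homogeneous m h \<Longrightarrow> p \<in> S \<Longrightarrow> (\<Sum>j\<in>UNIV. y j p * d_y j h p) = m * h p" for h :: "_ \<Rightarrow> real"
  unfolding fiber_homogeneous_def by (drule (1) bspec) simp

lemma homogeneous_L: "fiber_homogeneous 2 L"
  unfolding fiber_homogeneous_def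
proof
  fix p assume p: "p \<in> S"
  obtain z v where zv: "p = (z, v)" by force
  have z: "z \<in> U" and v: "v \<noteq> 0" using p zv by auto
  have "((\<lambda>t. (1 + t)\<^sup>2 * L p) has_vector_derivative 2 * L p) (at 0)"
    by (auto intro!: derivative_eq_intros simp: has_real_derivative_iff_has_vector_derivative[symmetric])
  then have "((\<lambda>t. L (p + t *\<^sub>R (0, v))) has_vector_derivative 2 * L p) (at 0)"
  proof (rule has_vector_derivative_transform_within_open[where S="{-1<..<1}"])
    fix t :: real assume t: "t \<in> {-1<..<1}"
    have "p + t *\<^sub>R (0, v) = (z, (1 + t) *\<^sub>R v)" by (simp add: zv algebra_simps)
    then show "(1 + t)\<^sup>2 * L p = L (p + t *\<^sub>R (0, v))"
      using homogeneous[OF z v, of "1 + t"] t by (simp add: zv power_mult_distrib)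
  qed auto
  then have "dir_deriv (0, v) L p = 2 * L p"
    unfolding dir_deriv_def by (rule vector_derivative_at)
  then show "(\<Sum>j\<in>UNIV. y j p *\<^sub>R d_y j L p) = 2 *\<^sub>R L p"
    using fiber_derivative[OF smooth_L p, of v] by (simp add: zv)
qed

lemma fiber_homogeneous_d_y:
  fixes h :: "'n coords \<Rightarrow> 'b::{euclidean_space, real_normed_algebra_1}"
  assumes h: "C_infinity_on h S" and hom: "fiber_homogeneous m h"
  shows "fiber_homogeneous (m - 1) (d_y k h)"
  unfolding fiber_homogeneous_def
proof
  fix p assume p: "p \<in> S"
  have sy: "C_infinity_on (\<lambda>q. of_real (y j q) :: 'b) S" for j
    by (rule smooth_bounded_linear[OF open_S bounded_linear_of_real smooth_y])
  have dy: "d_y k (\<lambda>q. of_real (y j q) :: 'b) p = of_real (d_y k (y j) p)" for j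
    unfolding d_y_def by (rule dir_deriv_bounded_linear[OF bounded_linear_of_real smooth_y p])
  have "d_y k (\<lambda>q. \<Sum>j\<in>UNIV. of_real (y j q) * d_y j h q) p = d_y k (\<lambda>q. of_real m * h q) p"
  proof (rule d_y_cong[OF p])
    fix q assume "q \<in> S"
    with hom show "(\<Sum>j\<in>UNIV. of_real (y j q) * d_y j h q) = of_real m * h q"
      unfolding fiber_homogeneous_def scaleR_conv_of_real by blast
  qed (intro smooth_rules sy h)
  also have "d_y k (\<lambda>q. of_real m * h q) p = of_real m * d_y k h p"
    using p h by (simp add: d_y_rules smooth_rules) (simp add: d_y_def)
  also have "d_y k (\<lambda>q. \<Sum>j\<in>UNIV. of_real (y j q) * d_y j h q) p =
      (\<Sum>j\<in>UNIV. of_real (y j p) * d_y k (d_y j h) p + of_real (d_y k (y j) p) * d_y j h p)"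
    using p h sy by (simp add: d_y_rules smooth_rules dy)
  also have "\<dots> = (\<Sum>j\<in>UNIV. of_real (y j p) * d_y j (d_y k h) p) + d_y k h p"
    using p h by (simp add: sum.distrib d_y_y d_y_d_y[of h p k] if_distrib[where f=of_real]
        if_distrib[where f="\<lambda>x. x * _"] cong: if_cong)
  finally show "(\<Sum>j\<in>UNIV. y j p *\<^sub>R d_y j (d_y k h) p) = (m - 1) *\<^sub>R d_y k h p"
    by (simp add: scaleR_conv_of_real algebra_simps)
qed

lemma fiber_homogeneous_d_x:
  fixes h :: "'n coords \<Rightarrow> 'b::{euclidean_space, real_normed_algebra_1}"
  assumes h: "C_infinity_on h S" and hom: "fiber_homogeneous m h"
  shows "fiber_homogeneous m (d_x k h)"
  unfolding fiber_homogeneous_def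
proof
  fix p assume p: "p \<in> S"
  have sy: "C_infinity_on (\<lambda>q. of_real (y j q) :: 'b) S" for j
    by (rule smooth_bounded_linear[OF open_S bounded_linear_of_real smooth_y])
  have dx: "d_x k (\<lambda>q. of_real (y j q) :: 'b) p = of_real (d_x k (y j) p)" for j
    unfolding d_x_def by (rule dir_deriv_bounded_linear[OF bounded_linear_of_real smooth_y p])
  have "d_x k (\<lambda>q. \<Sum>j\<in>UNIV. of_real (y j q) * d_y j h q) p = d_x k (\<lambda>q. of_real m * h q) p"
  proof (rule d_x_cong[OF p])
    fix q assume "q \<in> S"
    with hom show "(\<Sum>j\<in>UNIV. of_real (y j q) * d_y j h q) = of_real m * h q"
      unfolding fiber_homogeneous_def scaleR_conv_of_real by blast
  qed (intro smooth_rules sy h)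
  also have "d_x k (\<lambda>q. of_real m * h q) p = of_real m * d_x k h p"
    using p h by (simp add: d_x_rules smooth_rules) (simp add: d_x_def)
  also have "d_x k (\<lambda>q. \<Sum>j\<in>UNIV. of_real (y j q) * d_y j h q) p =
      (\<Sum>j\<in>UNIV. of_real (y j p) * d_x k (d_y j h) p)"
    using p h sy by (simp add: d_x_rules smooth_rules dx d_x_y)
  finally show "(\<Sum>j\<in>UNIV. y j p *\<^sub>R d_y j (d_x k h) p) = m *\<^sub>R d_x k h p"
    using p h by (simp add: scaleR_conv_of_real d_y_d_x)
qed

text \<open>Euler's identity for the derivatives of $L$: contraction with $y$ strips one fibre index and
  multiplies by the degree of what remains.\<close>

lemma euler_L_y: "p \<in> S \<Longrightarrow> (\<Sum>j\<in>UNIV. y j p * d_y j (d_y k L) p) = d_y k L p"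
  using fiber_homogeneousD[OF fiber_homogeneous_d_y[OF smooth_L homogeneous_L]] by simp

lemma euler_L_yy: "p \<in> S \<Longrightarrow> (\<Sum>j\<in>UNIV. y j p * d_y j (d_y k (d_y l L)) p) = 0"
  using fiber_homogeneousD[OF fiber_homogeneous_d_y[OF smooth_d_y[OF smooth_L]
    fiber_homogeneous_d_y[OF smooth_L homogeneous_L]]] by simp

lemma euler_L_x: "p \<in> S \<Longrightarrow> (\<Sum>j\<in>UNIV. y j p * d_x k (d_y j L) p) = 2 * d_x k L p"
  using fiber_homogeneousD[OF fiber_homogeneous_d_x[OF smooth_L homogeneous_L]]
  by (simp add: d_y_d_x smooth_L)

lemma euler_L_xy: "p \<in> S \<Longrightarrow> (\<Sum>j\<in>UNIV. y j p * d_x k (d_y j (d_y l L)) p) = d_x k (d_y l L) p"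
  using fiber_homogeneousD[OF fiber_homogeneous_d_x[OF smooth_d_y[OF smooth_L]
    fiber_homogeneous_d_y[OF smooth_L homogeneous_L]]]
  by (simp add: d_y_d_x smooth_L smooth_d_y)

lemma L_yy_sym: "p \<in> S \<Longrightarrow> d_y i (d_y j L) p = d_y j (d_y i L) p"
  by (rule d_y_d_y[OF smooth_L])

lemma L_xyy_sym: "p \<in> S \<Longrightarrow> d_x i (d_y j (d_y k L)) p = d_x i (d_y k (d_y j L)) p"
  by (rule d_x_cong) (auto intro: L_yy_sym smooth_rules)

lemma L_yyy_sym: "p \<in> S \<Longrightarrow> d_y i (d_y j (d_y k L)) p = d_y i (d_y k (d_y j L)) p"
  by (rule d_y_cong) (auto intro: L_yy_sym smooth_rules)

lemma g_mat_nth: "g_mat f p $ j $ k = 1/2 * d_y j (d_y k L) p"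
  by (simp add: g_mat_def)

lemma g_invertible: "p \<in> S \<Longrightarrow> invertible (g_mat f p)"
proof -
  assume p: "p \<in> S"
  have "u = 0" if "g_mat f p *v u = 0" for u
    using g_pos[OF p, of u] that by force
  then show ?thesis
    by (simp add: invertible_left_inverse matrix_left_invertible_ker)
qed

text \<open>Identities for vectors are proved after lowering the index with $L_{y^sy^k} = 2g_{sk}$, where no
  derivative of the inverse matrix ever appears.\<close>

lemma hessian_cancel:
  assumes p: "p \<in> S"
    and eq: "\<And>s. (\<Sum>k\<in>UNIV. d_y s (d_y k L) p * a k) = (\<Sum>k\<in>UNIV. d_y s (d_y k L) p * b k)"
  shows "a k = b k"
proof -
  have "g_mat f p *v (\<chi> k. a k) = g_mat f p *v (\<chi> k. b k)"
    using eq by (simp add: vec_eq_iff matrix_vector_mult_def g_mat_nth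
        sum_divide_distrib[symmetric])
  then have "matrix_inv (g_mat f p) *v (g_mat f p *v (\<chi> k. a k)) =
      matrix_inv (g_mat f p) *v (g_mat f p *v (\<chi> k. b k))" by simp
  then have "(\<chi> k. a k) = (\<chi> k. b k)"
    by (simp add: matrix_vector_mul_assoc invertible_matrix_inv g_invertible[OF p])
  then show ?thesis by (simp add: vec_eq_iff)
qed

lemma hessian_g_inv:
  assumes p: "p \<in> S"
  shows "(\<Sum>k\<in>UNIV. d_y s (d_y k L) p * (\<Sum>l\<in>UNIV. g_inv f p $ k $ l * e l)) = 2 * e s"
proof -
  have "g_mat f p *v (matrix_inv (g_mat f p) *v (\<chi> l. e l)) = (\<chi> l. e l)"
    by (simp add: matrix_vector_mul_assoc invertible_matrix_inv g_invertible[OF p])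
  then have "(g_mat f p *v (matrix_inv (g_mat f p) *v (\<chi> l. e l))) $ s = e s" by simp
  then show ?thesis
    by (simp add: matrix_vector_mult_def g_mat_nth g_inv_def sum_divide_distrib[symmetric])
qed

definition spray_source :: "'n + 'n \<Rightarrow> 'n coords \<Rightarrow> real" where
  "spray_source l p = (\<Sum>a\<in>UNIV. d_x a (d_y l L) p * y a p) - d_x l L p"

lemma smooth_spray_source: "C_infinity_on (spray_source l) S"
  unfolding spray_source_def by (intro smooth_rules)

lemma spray_lowered:
  "p \<in> S \<Longrightarrow> (\<Sum>k\<in>UNIV. d_y s (d_y k L) p * G k p) = 1/2 * spray_source s p"
proof -
  assume p: "p \<in> S"
  have "G k p = (\<Sum>l\<in>UNIV. g_inv f p $ k $ l * (1/4 * spray_source l p))" for k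
    by (simp add: spray_def spray_source_def sum_distrib_left)
  then show ?thesis using hessian_g_inv[OF p, of s "\<lambda>l. 1/4 * spray_source l p"] by simp
qed

text \<open>By Cramer's rule the spray coefficients are quotients of polynomials in smooth functions.\<close>

lemma smooth_spray: "C_infinity_on (G k) S"
proof -
  define B where "B = (\<lambda>p. \<chi> i j. if j = k then 1/4 * spray_source i p else g_mat f p $ i $ j)"
  have smooth_det: "C_infinity_on (\<lambda>p. det (A p)) S"
    if "\<And>i j. C_infinity_on (\<lambda>p. A p $ i $ j) S" for A :: "'n coords \<Rightarrow> real^('n+'n)^('n+'n)"
    unfolding det_def using that by (intro smooth_rules)
  have sg: "C_infinity_on (\<lambda>p. g_mat f p $ i $ j) S" for i j
    unfolding g_mat_nth by (intro smooth_rules)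
  have "C_infinity_on (\<lambda>p. 1/4 * spray_source i p) S" for i
    by (intro smooth_rules smooth_spray_source)
  then have sB: "C_infinity_on (\<lambda>p. B p $ i $ j) S" for i j
    by (cases "j = k") (simp_all add: B_def sg)
  have d0: "det (g_mat f p) \<noteq> 0" if "p \<in> S" for p
    using g_invertible[OF that] by (simp add: invertible_det_nz)
  have "C_infinity_on (\<lambda>p. det (B p) / det (g_mat f p)) S"
    by (intro smooth_divide open_S smooth_det sB sg d0)
  then show ?thesis
  proof (rule smooth_cong[OF open_S])
    fix p assume p: "p \<in> S"
    have "g_mat f p *v (\<chi> k. G k p) = (\<chi> i. 1/4 * spray_source i p)"
      using spray_lowered[OF p]
      by (simp add: vec_eq_iff matrix_vector_mult_def g_mat_nth sum_divide_distrib[symmetric]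
          mult.commute)
    then have "(\<chi> k. G k p) = (\<chi> k. det (\<chi> i j. if j = k
        then (\<chi> i. 1/4 * spray_source i p) $ i else g_mat f p $ i $ j) / det (g_mat f p))"
      using cramer[OF d0[OF p]] by blast
    then show "det (B p) / det (g_mat f p) = G k p"
      by (simp add: vec_eq_iff B_def cong: if_cong)
  qed
qed

text \<open>The fibre derivative of the lowered spray equation $L_{sk}\hat G^k = \frac12 E_s$, with
  $E_s = y^a\,\partial_{x^a} L_s - \partial_{x^s} L$.\<close>

lemma N_lowered:
  assumes p: "p \<in> S"
  shows "(\<Sum>k\<in>UNIV. d_y s (d_y k L) p * N k l p) =
    1/2 * ((\<Sum>a\<in>UNIV. y a p * d_x a (d_y l (d_y s L)) p) + d_x l (d_y s L) p - d_x s (d_y l L) p)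
    - (\<Sum>k\<in>UNIV. d_y l (d_y s (d_y k L)) p * G k p)"
proof -
  have "d_y l (\<lambda>q. \<Sum>k\<in>UNIV. d_y s (d_y k L) q * G k q) p = d_y l (\<lambda>q. 1/2 * spray_source s q) p"
    by (rule d_y_cong[OF p spray_lowered]) (auto intro!: smooth_rules smooth_spray)
  moreover have "d_y l (\<lambda>q. \<Sum>k\<in>UNIV. d_y s (d_y k L) q * G k q) p =
      (\<Sum>k\<in>UNIV. d_y s (d_y k L) p * N k l p) + (\<Sum>k\<in>UNIV. d_y l (d_y s (d_y k L)) p * G k p)"
    using p by (simp add: d_y_rules smooth_rules smooth_spray sum.distrib nonlin_conn_def)
  moreover have "d_y l (\<lambda>q. 1/2 * spray_source s q) p = 1/2 * d_y l (spray_source s) p"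
    using p by (subst d_y_rules(4)) (simp_all add: smooth_rules smooth_spray_source d_y_def)
  moreover have "d_y l (spray_source s) p =
      (\<Sum>a\<in>UNIV. y a p * d_x a (d_y l (d_y s L)) p) + d_x l (d_y s L) p - d_x s (d_y l L) p"
    using p unfolding spray_source_def
    by (simp add: d_y_rules smooth_rules sum.distrib d_y_y d_y_d_x mult_delta_left mult_delta_right
        mult.commute)
  ultimately show ?thesis by argo
qed

text \<open>Euler's identity for the spray, of degree 2.  It is the formula for the lowered nonlinear
  connection contracted with $y^l$.\<close>

lemma N_euler:
  assumes p: "p \<in> S"
  shows "(\<Sum>l\<in>UNIV. N k l p * y l p) = 2 * G k p"
proof (rule hessian_cancel[OF p])
  fix s
  have "(\<Sum>k\<in>UNIV. d_y s (d_y k L) p * (\<Sum>l\<in>UNIV. N k l p * y l p)) =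
      (\<Sum>l\<in>UNIV. y l p * (\<Sum>k\<in>UNIV. d_y s (d_y k L) p * N k l p))"
    unfolding sum_distrib_left by (subst sum.swap) (simp add: mult_ac)
  also have "\<dots> = 1/2 * ((\<Sum>l\<in>UNIV. \<Sum>a\<in>UNIV. y l p * (y a p * d_x a (d_y l (d_y s L)) p))
        + (\<Sum>l\<in>UNIV. y l p * d_x l (d_y s L) p) - (\<Sum>l\<in>UNIV. y l p * d_x s (d_y l L) p))
      - (\<Sum>l\<in>UNIV. \<Sum>k\<in>UNIV. y l p * (d_y l (d_y s (d_y k L)) p * G k p))"
    unfolding N_lowered[OF p]
    by (simp add: algebra_simps sum.distrib sum_subtractf sum_distrib_left sum_divide_distrib)
  also have "(\<Sum>l\<in>UNIV. \<Sum>a\<in>UNIV. y l p * (y a p * d_x a (d_y l (d_y s L)) p)) =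
      (\<Sum>a\<in>UNIV. y a p * (\<Sum>l\<in>UNIV. y l p * d_x a (d_y l (d_y s L)) p))"
    by (subst sum.swap) (simp add: mult_ac sum_distrib_left)
  also have "\<dots> = (\<Sum>a\<in>UNIV. y a p * d_x a (d_y s L) p)"
    using p by (simp add: euler_L_xy)
  also have "(\<Sum>l\<in>UNIV. \<Sum>k\<in>UNIV. y l p * (d_y l (d_y s (d_y k L)) p * G k p)) =
      (\<Sum>k\<in>UNIV. G k p * (\<Sum>l\<in>UNIV. y l p * d_y l (d_y s (d_y k L)) p))"
    by (subst sum.swap) (simp add: mult_ac sum_distrib_left)
  also have "\<dots> = 0" using p by (simp add: euler_L_yy)
  also have "(\<Sum>l\<in>UNIV. y l p * d_x s (d_y l L) p) = 2 * d_x s L p"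
    using p by (rule euler_L_x)
  finally show "(\<Sum>k\<in>UNIV. d_y s (d_y k L) p * (\<Sum>l\<in>UNIV. N k l p * y l p)) =
      (\<Sum>k\<in>UNIV. d_y s (d_y k L) p * (2 * G k p))"
    using spray_lowered[OF p, of s]
    by (simp add: spray_source_def mult_ac sum_distrib_left[symmetric] mult.left_commute[of _ 2])
qed

text \<open>$F^2$ is constant along horizontal curves: $\delta F^2/\delta x^l = 0$.  This is the lowered formula
  for the nonlinear connection contracted with $y^s$, as $y^sL_{sk} = L_k$.\<close>

lemma horizontal_L:
  assumes p: "p \<in> S"
  shows "d_x l L p = (\<Sum>k\<in>UNIV. N k l p * d_y k L p)"
proof -
  have "(\<Sum>k\<in>UNIV. N k l p * d_y k L p) =
      (\<Sum>k\<in>UNIV. N k l p * (\<Sum>s\<in>UNIV. y s p * d_y s (d_y k L) p))"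
    using p by (simp add: euler_L_y)
  also have "\<dots> = (\<Sum>s\<in>UNIV. y s p * (\<Sum>k\<in>UNIV. d_y s (d_y k L) p * N k l p))"
    unfolding sum_distrib_left by (subst sum.swap) (simp add: mult_ac)
  also have "\<dots> = 1/2 * ((\<Sum>s\<in>UNIV. \<Sum>a\<in>UNIV. y s p * (y a p * d_x a (d_y l (d_y s L)) p))
        + (\<Sum>s\<in>UNIV. y s p * d_x l (d_y s L) p) - (\<Sum>s\<in>UNIV. y s p * d_x s (d_y l L) p))
      - (\<Sum>s\<in>UNIV. \<Sum>k\<in>UNIV. y s p * (d_y l (d_y s (d_y k L)) p * G k p))"
    unfolding N_lowered[OF p]
    by (simp add: algebra_simps sum.distrib sum_subtractf sum_distrib_left sum_divide_distrib)
  also have "(\<Sum>s\<in>UNIV. \<Sum>a\<in>UNIV. y s p * (y a p * d_x a (d_y l (d_y s L)) p)) =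
      (\<Sum>a\<in>UNIV. y a p * (\<Sum>s\<in>UNIV. y s p * d_x a (d_y s (d_y l L)) p))"
    using p by (subst sum.swap) (simp add: mult_ac sum_distrib_left L_xyy_sym[of p _ l])
  also have "\<dots> = (\<Sum>a\<in>UNIV. y a p * d_x a (d_y l L) p)"
    using p by (simp add: euler_L_xy)
  also have "(\<Sum>s\<in>UNIV. \<Sum>k\<in>UNIV. y s p * (d_y l (d_y s (d_y k L)) p * G k p)) =
      (\<Sum>k\<in>UNIV. G k p * (\<Sum>s\<in>UNIV. y s p * d_y s (d_y l (d_y k L)) p))"
    using p by (subst sum.swap)
      (simp add: mult_ac sum_distrib_left d_y_d_y[OF smooth_d_y[OF smooth_L], of p l])
  also have "\<dots> = 0" using p by (simp add: euler_L_yy)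
  also have "(\<Sum>s\<in>UNIV. y s p * d_x l (d_y s L) p) = 2 * d_x l L p"
    using p by (rule euler_L_x)
  finally show ?thesis by simp
qed

lemma delta_g:
  assumes p: "p \<in> S"
  shows "delta_x f l (\<lambda>q. g_mat f q $ i $ j) p =
    1/2 * (d_x l (d_y i (d_y j L)) p - (\<Sum>m\<in>UNIV. N m l p * d_y m (d_y i (d_y j L)) p))"
proof -
  have *: "d_x l (\<lambda>q. 1/2 * d_y i (d_y j L) q) p = 1/2 * d_x l (d_y i (d_y j L)) p"
    "d_y m (\<lambda>q. 1/2 * d_y i (d_y j L) q) p = 1/2 * d_y m (d_y i (d_y j L)) p" for m
    by (subst d_x_rules(4) d_y_rules(4), (intro smooth_rules)+, rule p, simp add: d_x_def d_y_def)+
  then show ?thesis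
    unfolding delta_x_def g_mat_nth *
    by (simp add: sum_distrib_left right_diff_distrib mult.left_commute)
qed

lemma Cartan_h_sym: "p \<in> S \<Longrightarrow> Cartan_h f k j l p = Cartan_h f k l j p"
  unfolding Cartan_h_def
  by (rule sum.cong) (simp_all add: delta_g L_xyy_sym[of p _ l] L_yyy_sym[of p _ l] L_xyy_sym[of p _ _ j] L_yyy_sym[of p _ _ j])

text \<open>$\hat\Gamma^k_{j;l}\,y^j = \hat\Gamma^k_l$.  Lowering $k$, the contraction with $y^j$ kills the terms
  $\hat\Gamma^m_l\,\partial_{y^m} g_{sj}$ and $\hat\Gamma^m_s\,\partial_{y^m} g_{jl}$, and Euler's identity
  for the spray turns the remaining one into the term of the lowered nonlinear connection.\<close>

lemma Cartan_h_contract: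
  assumes p: "p \<in> S"
  shows "(\<Sum>j\<in>UNIV. Cartan_h f k j l p * y j p) = N k l p"
proof (rule hessian_cancel[OF p, where k=k and b="\<lambda>k. N k l p"])
  fix s
  define T where "T = (\<lambda>s j. 1/2 * (delta_x f l (\<lambda>q. g_mat f q $ s $ j) p
      - delta_x f s (\<lambda>q. g_mat f q $ j $ l) p + delta_x f j (\<lambda>q. g_mat f q $ l $ s) p))"
  have h: "Cartan_h f k j l p = (\<Sum>s\<in>UNIV. g_inv f p $ k $ s * T s j)" for k j
    by (simp add: Cartan_h_def T_def)
  have "(\<Sum>k\<in>UNIV. d_y s (d_y k L) p * (\<Sum>j\<in>UNIV. Cartan_h f k j l p * y j p)) =
      (\<Sum>j\<in>UNIV. y j p * (\<Sum>k\<in>UNIV. d_y s (d_y k L) p * Cartan_h f k j l p))"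
    unfolding sum_distrib_left by (subst sum.swap) (simp add: mult_ac)
  also have "\<dots> = (\<Sum>j\<in>UNIV. y j p * (2 * T s j))"
    unfolding h hessian_g_inv[OF p] ..
  also have "\<dots> = 1/2 * ((\<Sum>j\<in>UNIV. y j p * d_x l (d_y s (d_y j L)) p)
      - (\<Sum>j\<in>UNIV. \<Sum>m\<in>UNIV. y j p * (N m l p * d_y m (d_y s (d_y j L)) p))
      - (\<Sum>j\<in>UNIV. y j p * d_x s (d_y j (d_y l L)) p)
      + (\<Sum>j\<in>UNIV. \<Sum>m\<in>UNIV. y j p * (N m s p * d_y m (d_y j (d_y l L)) p))
      + (\<Sum>j\<in>UNIV. y j p * d_x j (d_y l (d_y s L)) p)
      - (\<Sum>j\<in>UNIV. \<Sum>m\<in>UNIV. y j p * (N m j p * d_y m (d_y l (d_y s L)) p)))"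
    unfolding T_def delta_g[OF p]
    by (simp add: algebra_simps sum.distrib sum_subtractf sum_distrib_left sum_divide_distrib)
  also have "(\<Sum>j\<in>UNIV. y j p * d_x l (d_y s (d_y j L)) p) = d_x l (d_y s L) p"
    using euler_L_xy[OF p, of l s] p by (simp add: L_xyy_sym[of p l s])
  also have "(\<Sum>j\<in>UNIV. \<Sum>m\<in>UNIV. y j p * (N m l p * d_y m (d_y s (d_y j L)) p)) =
      (\<Sum>m\<in>UNIV. N m l p * (\<Sum>j\<in>UNIV. y j p * d_y j (d_y m (d_y s L)) p))"
    using p by (subst sum.swap)
      (simp add: mult_ac sum_distrib_left L_yyy_sym[of p _ s] d_y_d_y[OF smooth_d_y[OF smooth_L], of p _ _ s])
  also have "\<dots> = 0" using p by (simp add: euler_L_yy)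
  also have "(\<Sum>j\<in>UNIV. y j p * d_x s (d_y j (d_y l L)) p) = d_x s (d_y l L) p"
    by (rule euler_L_xy[OF p])
  also have "(\<Sum>j\<in>UNIV. \<Sum>m\<in>UNIV. y j p * (N m s p * d_y m (d_y j (d_y l L)) p)) =
      (\<Sum>m\<in>UNIV. N m s p * (\<Sum>j\<in>UNIV. y j p * d_y j (d_y m (d_y l L)) p))"
    using p by (subst sum.swap)
      (simp add: mult_ac sum_distrib_left d_y_d_y[OF smooth_d_y[OF smooth_L], of p _ _ l])
  also have "\<dots> = 0" using p by (simp add: euler_L_yy)
  also have "(\<Sum>j\<in>UNIV. \<Sum>m\<in>UNIV. y j p * (N m j p * d_y m (d_y l (d_y s L)) p)) =
      (\<Sum>m\<in>UNIV. (\<Sum>j\<in>UNIV. N m j p * y j p) * d_y m (d_y l (d_y s L)) p)"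
    by (subst sum.swap) (simp add: mult_ac sum_distrib_left sum_distrib_right)
  also have "\<dots> = 2 * (\<Sum>m\<in>UNIV. d_y l (d_y s (d_y m L)) p * G m p)"
    using p unfolding N_euler[OF p] sum_distrib_left
    by (simp add: mult_ac L_yyy_sym[of p l s] d_y_d_y[OF smooth_d_y[OF smooth_L], of p _ l])
  finally show "(\<Sum>k\<in>UNIV. d_y s (d_y k L) p * (\<Sum>j\<in>UNIV. Cartan_h f k j l p * y j p)) =
      (\<Sum>k\<in>UNIV. d_y s (d_y k L) p * N k l p)"
    unfolding N_lowered[OF p] by argo
qed

end

section \<open>Wirtinger derivatives and the Levi form\<close>

text \<open>The operators $\partial/\partial z^\alpha$, $\partial/\partial v^\alpha$ and $\partial/\partial\bar v^\alpha$
  are all of this shape, so that their calculus needs to be developed only once.\<close>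

definition wirtinger ::
    "'a::euclidean_space \<Rightarrow> 'a \<Rightarrow> complex \<Rightarrow> ('a \<Rightarrow> complex) \<Rightarrow> 'a \<Rightarrow> complex" where
  "wirtinger u w c h p = (dir_deriv u h p + c * dir_deriv w h p) / 2"

lemma d_z_wirtinger: "d_z \<alpha> = wirtinger (real_basis (Inl \<alpha>), 0) (real_basis (Inr \<alpha>), 0) (- \<i>)"
  by (intro ext) (simp add: wirtinger_def d_z_def d_x_def)

lemma d_v_wirtinger: "d_v \<alpha> = wirtinger (0, real_basis (Inl \<alpha>)) (0, real_basis (Inr \<alpha>)) (- \<i>)"
  by (intro ext) (simp add: wirtinger_def d_v_def d_y_def)

lemma d_vbar_wirtinger: "d_vbar \<alpha> = wirtinger (0, real_basis (Inl \<alpha>)) (0, real_basis (Inr \<alpha>)) \<i>"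
  by (intro ext) (simp add: wirtinger_def d_vbar_def d_y_def)

lemmas wirtinger_operators = d_z_wirtinger d_v_wirtinger d_vbar_wirtinger

lemma smooth_wirtinger:
  assumes "open S" "C_infinity_on h S"
  shows "C_infinity_on (wirtinger u w c h) S"
proof -
  have "C_infinity_on (\<lambda>p. (1/2) * (dir_deriv u h p + c * dir_deriv w h p)) S"
    by (intro smooth_mult smooth_add smooth_const smooth_dir_deriv assms)
  then show ?thesis by (rule smooth_cong[OF assms(1)]) (simp add: wirtinger_def)
qed

lemma wirtinger_sum:
  assumes "\<And>i. i \<in> I \<Longrightarrow> C_infinity_on (h i) S" "p \<in> S"
  shows "wirtinger u w c (\<lambda>q. \<Sum>i\<in>I. h i q) p = (\<Sum>i\<in>I. wirtinger u w c (h i) p)"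
proof -
  have "dir_deriv a (\<lambda>q. \<Sum>i\<in>I. h i q) p = (\<Sum>i\<in>I. dir_deriv a (h i) p)" for a
    using assms by (rule dir_deriv_sum)
  then show ?thesis
    by (simp add: wirtinger_def sum_distrib_left sum.distrib sum_divide_distrib add_divide_distrib)
qed

lemma wirtinger_mult:
  assumes "C_infinity_on h S" "C_infinity_on k S" "p \<in> S"
  shows "wirtinger u w c (\<lambda>q. h q * k q) p = h p * wirtinger u w c k p + wirtinger u w c h p * k p"
  using assms by (simp add: wirtinger_def dir_deriv_mult field_simps)

lemma wirtinger_cong:
  assumes "open S" "p \<in> S" "\<And>q. q \<in> S \<Longrightarrow> h q = k q" "C_infinity_on h S"
  shows "wirtinger u w c h p = wirtinger u w c k p"
  using dir_deriv_cong[OF assms] by (simp add: wirtinger_def)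

lemma dir_deriv_wirtinger:
  assumes S: "open S" and h: "C_infinity_on h S" and p: "p \<in> S"
  shows "dir_deriv a (wirtinger u w c h) p = wirtinger u w c (dir_deriv a h) p"
proof -
  have scale: "dir_deriv a (\<lambda>q. b * k q) p = b * dir_deriv a k p" if "C_infinity_on k S"
    for b and k :: "'a \<Rightarrow> complex"
    by (rule dir_deriv_bounded_linear[OF bounded_linear_mult_right that p])
  have "dir_deriv a (wirtinger u w c h) p =
      dir_deriv a (\<lambda>q. (1/2) * (dir_deriv u h q + c * dir_deriv w h q)) p"
    by (rule dir_deriv_cong[OF S p _ smooth_wirtinger[OF S h]]) (simp add: wirtinger_def)
  also have "\<dots> = (1/2) * (dir_deriv a (dir_deriv u h) p + c * dir_deriv a (dir_deriv w h) p)"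
    by (subst scale dir_deriv_add[where S=S],
        (intro smooth_add smooth_mult smooth_const smooth_dir_deriv S h p)+)+ (rule refl)
  finally show ?thesis
    by (simp add: wirtinger_def dir_deriv_commute[OF S h p])
qed

lemma wirtinger_commute:
  assumes S: "open S" and h: "C_infinity_on h S" and p: "p \<in> S"
  shows "wirtinger u w c (wirtinger u' w' c' h) p = wirtinger u' w' c' (wirtinger u w c h) p"
proof -
  have "wirtinger u w c (wirtinger u' w' c' h) p =
      (wirtinger u' w' c' (dir_deriv u h) p + c * wirtinger u' w' c' (dir_deriv w h) p) / 2"
    unfolding wirtinger_def[of u w c] by (simp add: dir_deriv_wirtinger[OF S h p])
  also have "\<dots> = wirtinger u' w' c' (wirtinger u w c h) p"
    by (simp add: wirtinger_def[of u' w' c'] dir_deriv_wirtinger[OF S h p])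
       (simp add: wirtinger_def field_simps dir_deriv_commute[OF S h p, of u u']
         dir_deriv_commute[OF S h p, of u w'] dir_deriv_commute[OF S h p, of w u']
         dir_deriv_commute[OF S h p, of w w'])
  finally show ?thesis .
qed

\<comment> \<open>keeps \<open>Lc\<close> below in the form of a real function composed with the embedding\<close>
declare of_real_power [simp del]

context Finsler_rep
begin

abbreviation "Lc \<equiv> \<lambda>q. complex_of_real ((f q)\<^sup>2)"

lemma smooth_Lc: "C_infinity_on Lc S"
  by (rule smooth_bounded_linear[OF open_S bounded_linear_of_real smooth_L])

lemma smooth_complex_derivatives:
  "C_infinity_on h S \<Longrightarrow> C_infinity_on (d_z \<alpha> h) S"
  "C_infinity_on h S \<Longrightarrow> C_infinity_on (d_v \<alpha> h) S"
  "C_infinity_on h S \<Longrightarrow> C_infinity_on (d_vbar \<alpha> h) S"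
  unfolding wirtinger_operators by (rule smooth_wirtinger[OF open_S]; assumption)+

lemma d_x_Lc: "p \<in> S \<Longrightarrow> d_x j Lc p = of_real (d_x j L p)"
  unfolding d_x_def by (rule dir_deriv_bounded_linear[OF bounded_linear_of_real smooth_L])

lemma d_y_Lc: "p \<in> S \<Longrightarrow> d_y j Lc p = of_real (d_y j L p)"
  unfolding d_y_def by (rule dir_deriv_bounded_linear[OF bounded_linear_of_real smooth_L])

lemma d_y_d_y_Lc: "p \<in> S \<Longrightarrow> d_y i (d_y j Lc) p = of_real (d_y i (d_y j L) p)"
proof -
  assume p: "p \<in> S"
  have "d_y i (d_y j Lc) p = d_y i (\<lambda>q. of_real (d_y j L q)) p"
    by (rule d_y_cong[OF p d_y_Lc]) (assumption, intro smooth_rules smooth_Lc)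
  also have "\<dots> = of_real (d_y i (d_y j L) p)"
    unfolding d_y_def
    by (rule dir_deriv_bounded_linear[OF bounded_linear_of_real smooth_dir_deriv[OF open_S smooth_L] p])
  finally show ?thesis .
qed

lemma G_mat_nth: "(\<lambda>q. G_mat f q $ \<alpha> $ \<beta>) = d_v \<alpha> (d_vbar \<beta> Lc)"
  by (rule ext) (simp add: G_mat_def)

lemma G_mat_real_hessian:
  assumes p: "p \<in> S"
  shows "G_mat f p $ \<alpha> $ \<beta> =
    Complex (d_y (Inl \<alpha>) (d_y (Inl \<beta>) L) p + d_y (Inr \<alpha>) (d_y (Inr \<beta>) L) p)
      (d_y (Inl \<alpha>) (d_y (Inr \<beta>) L) p - d_y (Inr \<alpha>) (d_y (Inl \<beta>) L) p) / 4"
proof -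
  have step: "d_y i (d_vbar \<beta> Lc) p = (d_y i (d_y (Inl \<beta>) Lc) p + \<i> * d_y i (d_y (Inr \<beta>) Lc) p) / 2" for i
  proof -
    have "d_y i (d_vbar \<beta> Lc) p = d_vbar \<beta> (d_y i Lc) p"
      unfolding d_vbar_wirtinger d_y_def by (rule dir_deriv_wirtinger[OF open_S smooth_Lc p])
    then show ?thesis by (simp add: d_vbar_def d_y_d_y[OF smooth_Lc p, of i])
  qed
  have "G_mat f p $ \<alpha> $ \<beta> = d_v \<alpha> (d_vbar \<beta> Lc) p" by (simp add: G_mat_def)
  also have "\<dots> = (d_y (Inl \<alpha>) (d_vbar \<beta> Lc) p - \<i> * d_y (Inr \<alpha>) (d_vbar \<beta> Lc) p) / 2"
    by (simp add: d_v_def)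
  finally show ?thesis
    unfolding step d_y_d_y_Lc[OF p]
    by (simp add: complex_eq_iff field_simps)
qed

text \<open>The Levi form is the Hermitian part of the real Hessian: for $x = a + ib$,
  $\bar x^\alpha G_{\alpha\bar\beta}x^\beta$ has real part $\frac12(g(u,u)+g(w,w))$ with $u = (a,-b)$ and
  $w = (b,a)$.  So it inherits positivity from $g$.\<close>

lemma G_invertible:
  assumes p: "p \<in> S"
  shows "invertible (G_mat f p)"
proof -
  have "x = 0" if x: "G_mat f p *v x = 0" for x
  proof (rule ccontr)
    assume "x \<noteq> 0"
    define u :: "real ^ ('n + 'n)" where
      "u = (\<chi> j. case j of Inl \<alpha> \<Rightarrow> Re (x $ \<alpha>) | Inr \<alpha> \<Rightarrow> - Im (x $ \<alpha>))"
    define w :: "real ^ ('n + 'n)" where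
      "w = (\<chi> j. case j of Inl \<alpha> \<Rightarrow> Im (x $ \<alpha>) | Inr \<alpha> \<Rightarrow> Re (x $ \<alpha>))"
    obtain \<alpha> where "x $ \<alpha> \<noteq> 0" using \<open>x \<noteq> 0\<close> by (auto simp: vec_eq_iff)
    then have "u \<noteq> 0" "w \<noteq> 0"
      by (auto simp: u_def w_def vec_eq_iff complex_eq_iff split: sum.splits
          intro: exI[of _ "Inl \<alpha>"] exI[of _ "Inr \<alpha>"])
    have quad: "a \<bullet> (g_mat f p *v a) =
        (\<Sum>\<alpha>\<in>UNIV. \<Sum>\<beta>\<in>UNIV. 1/2 *
          (a $ Inl \<alpha> * d_y (Inl \<alpha>) (d_y (Inl \<beta>) L) p * a $ Inl \<beta>
          + a $ Inl \<alpha> * d_y (Inl \<alpha>) (d_y (Inr \<beta>) L) p * a $ Inr \<beta>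
          + a $ Inr \<alpha> * d_y (Inr \<alpha>) (d_y (Inl \<beta>) L) p * a $ Inl \<beta>
          + a $ Inr \<alpha> * d_y (Inr \<alpha>) (d_y (Inr \<beta>) L) p * a $ Inr \<beta>))" for a
      by (simp add: inner_vec_def matrix_vector_mult_def g_mat_nth sum_UNIV_Plus sum.distrib
          sum_distrib_left algebra_simps sum_divide_distrib add_divide_distrib)
    have "0 = Re (\<Sum>\<alpha>\<in>UNIV. cnj (x $ \<alpha>) * (G_mat f p *v x) $ \<alpha>)"
      by (simp add: x)
    also have "\<dots> = (\<Sum>\<alpha>\<in>UNIV. \<Sum>\<beta>\<in>UNIV. Re (cnj (x $ \<alpha>) * (G_mat f p $ \<alpha> $ \<beta> * x $ \<beta>)))"
      by (simp only: matrix_vector_mult_def vec_lambda_beta sum_distrib_left Re_sum)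
    also have "\<dots> = (\<Sum>\<alpha>\<in>UNIV. \<Sum>\<beta>\<in>UNIV.
        ((Re (x $ \<alpha>) * Re (x $ \<beta>) + Im (x $ \<alpha>) * Im (x $ \<beta>))
          * (d_y (Inl \<alpha>) (d_y (Inl \<beta>) L) p + d_y (Inr \<alpha>) (d_y (Inr \<beta>) L) p)
        - (Re (x $ \<alpha>) * Im (x $ \<beta>) - Im (x $ \<alpha>) * Re (x $ \<beta>))
          * (d_y (Inl \<alpha>) (d_y (Inr \<beta>) L) p - d_y (Inr \<alpha>) (d_y (Inl \<beta>) L) p)) / 4)"
      unfolding G_mat_real_hessian[OF p] by (intro sum.cong refl) (simp add: field_simps)
    also have "\<dots> = (u \<bullet> (g_mat f p *v u) + w \<bullet> (g_mat f p *v w)) / 2"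
      unfolding quad sum.distrib[symmetric] sum_divide_distrib
      by (intro sum.cong refl) (simp add: u_def w_def field_simps)
    also have "\<dots> > 0"
      using g_pos[OF p \<open>u \<noteq> 0\<close>] g_pos[OF p \<open>w \<noteq> 0\<close>] by simp
    finally show False by simp
  qed
  then show ?thesis
    by (simp add: invertible_left_inverse matrix_left_invertible_ker)
qed

section \<open>Holomorphic functions on the punctured fibres\<close>

definition fiber_holomorphic :: "('n coords \<Rightarrow> complex) \<Rightarrow> bool" where
  "fiber_holomorphic h \<longleftrightarrow> (\<forall>p\<in>S. \<forall>\<tau>. d_vbar \<tau> h p = 0)"

lemma fiber_holomorphicD: "fiber_holomorphic h \<Longrightarrow> p \<in> S \<Longrightarrow> d_vbar \<tau> h p = 0"
  unfolding fiber_holomorphic_def by blast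

lemma fiber_holomorphic_d_y:
  assumes h: "C_infinity_on h S" and hol: "fiber_holomorphic h"
  shows "fiber_holomorphic (d_y j h)"
  unfolding fiber_holomorphic_def
proof (intro ballI allI)
  fix p \<tau> assume p: "p \<in> S"
  have "d_vbar \<tau> (d_y j h) p = d_y j (d_vbar \<tau> h) p"
    unfolding d_vbar_wirtinger d_y_def by (rule dir_deriv_wirtinger[OF open_S h p, symmetric])
  also have "\<dots> = d_y j (\<lambda>_. 0) p"
    by (intro d_y_cong[OF p] smooth_complex_derivatives h fiber_holomorphicD[OF hol])
  finally show "d_vbar \<tau> (d_y j h) p = 0" by (simp add: d_y_def)
qed

lemma fiber_holomorphic_Cauchy_Riemann:
  assumes "fiber_holomorphic h" "p \<in> S"
  shows "d_y (Inr \<alpha>) h p = \<i> * d_y (Inl \<alpha>) h p" "d_v \<alpha> h p = d_y (Inl \<alpha>) h p"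
proof -
  have "d_y (Inl \<alpha>) h p + \<i> * d_y (Inr \<alpha>) h p = 0"
    using fiber_holomorphicD[OF assms] by (simp add: d_vbar_def)
  then have "\<i> * (d_y (Inl \<alpha>) h p + \<i> * d_y (Inr \<alpha>) h p) = 0" by simp
  then have "\<i> * d_y (Inl \<alpha>) h p + (\<i> * \<i>) * d_y (Inr \<alpha>) h p = 0"
    by (simp only: distrib_left mult.assoc)
  then show *: "d_y (Inr \<alpha>) h p = \<i> * d_y (Inl \<alpha>) h p" by simp
  show "d_v \<alpha> h p = d_y (Inl \<alpha>) h p" by (simp add: d_v_def *)
qed

lemma homogeneous_ray:
  fixes h :: "'n coords \<Rightarrow> complex"
  assumes h: "C_infinity_on h S" and hom: "fiber_homogeneous 0 h"
    and z: "z \<in> U" and v: "v \<noteq> 0" and t: "t > 0"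
  shows "h (z, t *\<^sub>R v) = h (z, v)"
proof -
  have "\<exists>c. \<forall>t\<in>{0<..}. h (z, t *\<^sub>R v) = c"
  proof (rule has_derivative_zero_constant)
    fix t :: real assume t: "t \<in> {0<..}"
    then have p: "(z, t *\<^sub>R v) \<in> S" using z v by simp
    have "((\<lambda>t. h (z, t *\<^sub>R v)) has_derivative (\<lambda>r. dir_deriv (0, r *\<^sub>R v) h (z, t *\<^sub>R v))) (at t)"
    proof (rule has_derivative_compose[of "\<lambda>t. (z, t *\<^sub>R v)"])
      show "((\<lambda>t. (z, t *\<^sub>R v)) has_derivative (\<lambda>r. (0, r *\<^sub>R v))) (at t)"
        by (auto intro!: derivative_eq_intros)
    qed (rule smooth_has_derivative[OF h p])
    moreover have "dir_deriv (0, r *\<^sub>R v) h (z, t *\<^sub>R v) = 0" for r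
    proof -
      have "real_coord (r *\<^sub>R v) j = (r / t) * y j (z, t *\<^sub>R v)" for j
        using t by (simp add: real_coord_def split: sum.splits)
      then have "dir_deriv (0, r *\<^sub>R v) h (z, t *\<^sub>R v) =
          (r / t) *\<^sub>R (\<Sum>j\<in>UNIV. y j (z, t *\<^sub>R v) *\<^sub>R d_y j h (z, t *\<^sub>R v))"
        unfolding fiber_derivative[OF h p] by (simp only: scaleR_sum_right scaleR_scaleR)
      also have "(\<Sum>j\<in>UNIV. y j (z, t *\<^sub>R v) *\<^sub>R d_y j h (z, t *\<^sub>R v)) = 0"
        using bspec[OF hom[unfolded fiber_homogeneous_def] p] by simp
      finally show ?thesis by simp
    qed
    ultimately show "((\<lambda>t. h (z, t *\<^sub>R v)) has_derivative (\<lambda>r. 0)) (at t within {0<..})"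
      by (simp add: has_derivative_at_withinI)
  qed simp
  then obtain c where c: "\<And>t. t \<in> {0<..} \<Longrightarrow> h (z, t *\<^sub>R v) = c" by blast
  show ?thesis using c[of t] c[of 1] t by simp
qed

lemma bounded_homogeneous:
  fixes h :: "'n coords \<Rightarrow> complex"
  assumes h: "C_infinity_on h S" and hom: "fiber_homogeneous 0 h" and z: "z \<in> U"
  obtains B where "\<And>v. v \<noteq> 0 \<Longrightarrow> norm (h (z, v)) \<le> B"
proof -
  have "continuous_on (sphere 0 1) (\<lambda>v. h (z, v))"
    by (rule continuous_on_compose2[OF smooth_continuous_on[OF h]])
      (auto intro!: continuous_intros simp: z)
  then have "bounded ((\<lambda>v. h (z, v)) ` sphere 0 1)"
    by (intro compact_imp_bounded compact_continuous_image) auto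
  then obtain B where B: "\<And>v. v \<in> sphere 0 1 \<Longrightarrow> norm (h (z, v)) \<le> B"
    unfolding bounded_iff by blast
  show thesis
  proof
    fix v :: "complex ^ 'n" assume v: "v \<noteq> 0"
    have "h (z, (1 / norm v) *\<^sub>R v) = h (z, v)"
      using v by (intro homogeneous_ray[OF h hom z]) auto
    then show "norm (h (z, v)) \<le> B"
      using B[of "(1 / norm v) *\<^sub>R v"] v by simp
  qed
qed

text \<open>On a complex line in a fibre the Cauchy-Riemann equations turn the real Frechet derivative into
  a complex derivative.\<close>

lemma fiber_holomorphic_line:
  assumes h: "C_infinity_on h S" and hol: "fiber_holomorphic h"
    and p: "(z, v + t *s w) \<in> S"
  shows "((\<lambda>t. h (z, v + t *s w)) has_field_derivative
    (\<Sum>\<alpha>\<in>UNIV. w $ \<alpha> * d_y (Inl \<alpha>) h (z, v + t *s w))) (at t)"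
proof -
  let ?p = "(z, v + t *s w)"
  have bl: "bounded_linear (\<lambda>r. r *s w)"
    by (rule linear_conv_bounded_linear[THEN iffD1], rule linearI)
      (simp_all add: vec_eq_iff distrib_right)
  have "((\<lambda>t. h (z, v + t *s w)) has_derivative (\<lambda>r. dir_deriv (0, r *s w) h ?p)) (at t)"
  proof (rule has_derivative_compose[of "\<lambda>t. (z, v + t *s w)"])
    show "((\<lambda>t. (z, v + t *s w)) has_derivative (\<lambda>r. (0, r *s w))) (at t)"
      by (intro has_derivative_Pair has_derivative_const)
        (use has_derivative_add[OF has_derivative_const bounded_linear_imp_has_derivative[OF bl]] in simp)
  qed (rule smooth_has_derivative[OF h p])
  moreover have "dir_deriv (0, r *s w) h ?p = (\<Sum>\<alpha>\<in>UNIV. w $ \<alpha> * d_y (Inl \<alpha>) h ?p) * r" for r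
  proof -
    have "dir_deriv (0, r *s w) h ?p =
        (\<Sum>\<alpha>\<in>UNIV. (of_real (Re (r * w $ \<alpha>)) + \<i> * of_real (Im (r * w $ \<alpha>))) * d_y (Inl \<alpha>) h ?p)"
      unfolding fiber_derivative[OF h p] sum_UNIV_Plus sum.distrib[symmetric]
      by (intro sum.cong refl)
        (simp add: real_coord_def scaleR_conv_of_real fiber_holomorphic_Cauchy_Riemann[OF hol p]
          algebra_simps)
    also have "\<dots> = (\<Sum>\<alpha>\<in>UNIV. (r * w $ \<alpha>) * d_y (Inl \<alpha>) h ?p)"
      by (simp only: complex_eq[symmetric])
    finally show ?thesis by (simp add: sum_distrib_left mult_ac)
  qed
  ultimately show ?thesis by (simp add: has_field_derivative_def)
qed

text \<open>If the line $t \mapsto v+tw$ avoids 0, then the function is entire and bounded on it, hence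
  constant by Liouville's theorem.  By homogeneity its value at $v+tw$ is that at $v/t+w$, which tends
  to the value at $w$.\<close>

lemma constant_independent:
  assumes h: "C_infinity_on h S" and hol: "fiber_holomorphic h" and hom: "fiber_homogeneous 0 h"
    and z: "z \<in> U" and w: "w \<noteq> 0" and indep: "\<And>t. v + t *s w \<noteq> 0"
  shows "h (z, v) = h (z, w)"
proof -
  obtain B where B: "\<And>v. v \<noteq> 0 \<Longrightarrow> norm (h (z, v)) \<le> B"
    using bounded_homogeneous[OF h hom z] by blast
  have "(\<lambda>t. h (z, v + t *s w)) constant_on UNIV"
  proof (rule Liouville_theorem)
    show "(\<lambda>t. h (z, v + t *s w)) holomorphic_on UNIV"
      unfolding holomorphic_on_open[OF open_UNIV]
      using fiber_holomorphic_line[OF h hol] z indep by blast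
    show "bounded (range (\<lambda>t. h (z, v + t *s w)))"
      using B indep unfolding bounded_iff by blast
  qed
  then have const: "h (z, v + t *s w) = h (z, v + 0 *s w)" for t
    unfolding constant_on_def by (metis UNIV_I)
  have v: "v \<noteq> 0" using indep[of 0] by simp
  have eq: "h (z, v) = h (z, (1 / real (Suc n)) *\<^sub>R v + w)" for n
  proof -
    let ?t = "real (Suc n)"
    have t: "?t > 0" by simp
    have sc: "complex_of_real ?t *s w = ?t *\<^sub>R w"
      by (simp add: vec_eq_iff del: of_nat_Suc) (simp add: scaleR_conv_of_real del: of_nat_Suc)
    have "h (z, v) = h (z, v + ?t *\<^sub>R w)" using const[of "of_real ?t"] sc by simp
    also have "\<dots> = h (z, (1 / ?t) *\<^sub>R (v + ?t *\<^sub>R w))"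
      using indep[of "of_real ?t"] sc t by (intro homogeneous_ray[OF h hom z, symmetric]) auto
    also have "(1 / ?t) *\<^sub>R (v + ?t *\<^sub>R w) = (1 / ?t) *\<^sub>R v + w"
      using t by (simp add: scaleR_add_right del: of_nat_Suc)
    finally show ?thesis .
  qed
  have "isCont h (z, w)"
    using smooth_differentiable[OF h, of "(z, w)"] z w
    by (simp add: differentiable_imp_continuous_within)
  moreover have "(\<lambda>n. (z, (1 / real (Suc n)) *\<^sub>R v + w)) \<longlonglongrightarrow> (z, 0 *\<^sub>R v + w)"
    by (intro tendsto_intros LIMSEQ_Suc lim_1_over_n)
  ultimately have "(\<lambda>n. h (z, (1 / real (Suc n)) *\<^sub>R v + w)) \<longlonglongrightarrow> h (z, w)"
    using isCont_tendsto_compose by fastforce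
  then have "(\<lambda>n::nat. h (z, v)) \<longlonglongrightarrow> h (z, w)"
    unfolding eq[symmetric] .
  then show ?thesis by (simp add: LIMSEQ_const_iff)
qed

text \<open>Two vectors can be compared directly only if they are linearly independent; in dimension at
  least 2 dependent ones are compared through a third.\<close>

lemma fiber_constant:
  assumes h: "C_infinity_on h S" and hol: "fiber_holomorphic h" and hom: "fiber_homogeneous 0 h"
    and card: "CARD('n) \<ge> 2" and z: "z \<in> U" and v: "v \<noteq> 0" and w: "w \<noteq> 0"
  shows "h (z, v) = h (z, w)"
proof -
  obtain \<alpha> \<beta> :: 'n where ne: "\<alpha> \<noteq> \<beta>"
  proof -
    have "\<not> (\<forall>x y::'n. x = y)"
      using card card_le_Suc0_iff_eq[of "UNIV::'n set"] by auto
    then show thesis using that by blast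
  qed
  have axis: "h (z, v) = h (z, axis \<gamma> 1)" if "\<gamma> \<noteq> \<delta>" "v $ \<delta> \<noteq> 0" for v \<gamma> \<delta>
  proof (rule constant_independent[OF h hol hom z])
    fix t
    have "(v + t *s axis \<gamma> 1) $ \<delta> \<noteq> 0" using that by (simp add: axis_def)
    then show "v + t *s axis \<gamma> 1 \<noteq> 0" by (metis zero_index)
  qed (simp add: axis_eq_0_iff)
  have main: "h (z, v) = h (z, axis \<alpha> 1)" if v: "v \<noteq> 0" for v
  proof -
    obtain \<delta> where d: "v $ \<delta> \<noteq> 0" using v by (auto simp: vec_eq_iff)
    show ?thesis
    proof (cases "\<delta> = \<alpha>")
      case True
      then have "h (z, v) = h (z, axis \<beta> 1)" using axis[of \<beta> \<delta> v] d ne by auto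
      also have "\<dots> = h (z, axis \<alpha> 1)" using axis[of \<alpha> \<beta> "axis \<beta> 1"] ne by (simp add: axis_def)
      finally show ?thesis .
    next
      case False
      then show ?thesis using axis[of \<alpha> \<delta> v] d by auto
    qed
  qed
  show ?thesis using main[OF v] main[OF w] by simp
qed

end

section \<open>Horizontally parallel complex structure and holomorphy of the spray\<close>

lemma Cartan_connection_horizontal_const:
  "Cartan_connection f p (axis l 1, \<chi> k. - nonlin_conn f k l p) (\<lambda>_. Y) =
    (\<chi> k. \<Sum>j\<in>UNIV. Y $ j * Cartan_h f k j l p)"
  by (simp add: Cartan_connection_def vec_apply_def d_x_def d_y_def axis_def mult_delta_left
      mult_delta_right)

text \<open>Constant sections already carry all the information of the condition $\nabla_X\mathbf J = 0$, as
  their derivatives vanish and only the connection coefficients remain.\<close>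

locale J_parallel_Finsler_rep = Finsler_rep U f for U :: "(complex ^ 'n::finite) set" and f +
  assumes parallel: "\<And>p X Y. p \<in> U \<times> (- {0}) \<Longrightarrow> X \<in> horizontal_space f p \<Longrightarrow>
      Cartan_connection f p X (\<lambda>_. J_vert Y) = J_vert (Cartan_connection f p X (\<lambda>_. Y))"
begin

lemma Cartan_h_J:
  assumes p: "p \<in> S"
  shows "Cartan_h f (Inl \<gamma>) (Inr \<alpha>) l p = - Cartan_h f (Inr \<gamma>) (Inl \<alpha>) l p"
    "Cartan_h f (Inr \<gamma>) (Inr \<alpha>) l p = Cartan_h f (Inl \<gamma>) (Inl \<alpha>) l p"
proof -
  have X: "(axis l 1, \<chi> k. - N k l p) \<in> horizontal_space f p"
    unfolding horizontal_space_def by (intro span_base) simp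
  have J: "J_vert (axis (Inl \<alpha>) 1) = axis (Inr \<alpha>) 1"
    by (auto simp: J_vert_def vec_eq_iff axis_def split: sum.splits)
  have "(\<chi> k. Cartan_h f k (Inr \<alpha>) l p) = J_vert (\<chi> k. Cartan_h f k (Inl \<alpha>) l p)"
    using parallel[OF p X, of "axis (Inl \<alpha>) 1"]
    unfolding J Cartan_connection_horizontal_const by (simp add: axis_def mult_delta_left)
  then show "Cartan_h f (Inl \<gamma>) (Inr \<alpha>) l p = - Cartan_h f (Inr \<gamma>) (Inl \<alpha>) l p"
    "Cartan_h f (Inr \<gamma>) (Inr \<alpha>) l p = Cartan_h f (Inl \<gamma>) (Inl \<alpha>) l p"
    by (simp_all add: vec_eq_iff J_vert_def split: sum.splits)
qed

text \<open>The symmetry of $\hat\Gamma^k_{j;l}$ in $j,l$ moves the commutation with $\mathbf J$ from the index $j$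
  to the index $l$, where it survives the contraction with $y^j$.\<close>

lemma N_J:
  assumes p: "p \<in> S"
  shows "N (Inl \<gamma>) (Inr \<alpha>) p = - N (Inr \<gamma>) (Inl \<alpha>) p"
    "N (Inr \<gamma>) (Inr \<alpha>) p = N (Inl \<gamma>) (Inl \<alpha>) p"
proof -
  have N: "N k l p = (\<Sum>j\<in>UNIV. Cartan_h f k l j p * y j p)" for k l
    using Cartan_h_contract[OF p, of k l] by (simp add: Cartan_h_sym[OF p, of k _ l])
  show "N (Inl \<gamma>) (Inr \<alpha>) p = - N (Inr \<gamma>) (Inl \<alpha>) p"
    "N (Inr \<gamma>) (Inr \<alpha>) p = N (Inl \<gamma>) (Inl \<alpha>) p"
    unfolding N Cartan_h_J[OF p] by (simp_all add: sum_negf)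
qed

definition complex_spray :: "'n \<Rightarrow> 'n coords \<Rightarrow> complex" where
  "complex_spray \<alpha> p = of_real (G (Inl \<alpha>) p) + \<i> * of_real (G (Inr \<alpha>) p)"

abbreviation Nc :: "'n \<Rightarrow> 'n \<Rightarrow> 'n coords \<Rightarrow> complex" where
  "Nc \<alpha> \<mu> \<equiv> d_y (Inl \<mu>) (complex_spray \<alpha>)"

lemma smooth_complex_spray: "C_infinity_on (complex_spray \<alpha>) S"
  unfolding complex_spray_def
  by (intro smooth_rules smooth_bounded_linear[OF open_S bounded_linear_of_real] smooth_spray)

lemma smooth_Nc: "C_infinity_on (Nc \<alpha> \<mu>) S"
  by (intro smooth_rules smooth_complex_spray)

lemma d_y_complex_spray:
  assumes p: "p \<in> S"
  shows "d_y j (complex_spray \<alpha>) p = of_real (N (Inl \<alpha>) j p) + \<i> * of_real (N (Inr \<alpha>) j p)"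
proof -
  have sm: "C_infinity_on (\<lambda>q. complex_of_real (G k q)) S" for k
    by (rule smooth_bounded_linear[OF open_S bounded_linear_of_real smooth_spray])
  have dy: "d_y j (\<lambda>q. complex_of_real (G k q)) p = of_real (N k j p)" for k
    unfolding d_y_def nonlin_conn_def
    by (rule dir_deriv_bounded_linear[OF bounded_linear_of_real smooth_spray p])
  show ?thesis
    unfolding complex_spray_def
    by (simp add: d_y_rules smooth_rules sm p dy) (simp add: d_y_def)
qed

text \<open>The fibre derivative of the spray is the nonlinear connection, which is complex linear; these
  are the Cauchy-Riemann equations.\<close>

lemma holomorphic_complex_spray: "fiber_holomorphic (complex_spray \<alpha>)"
  unfolding fiber_holomorphic_def
  by (auto simp: d_vbar_def d_y_complex_spray N_J algebra_simps)

lemma homogeneous_complex_spray: "fiber_homogeneous 2 (complex_spray \<alpha>)"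
  unfolding fiber_homogeneous_def
proof
  fix p assume p: "p \<in> S"
  have "(\<Sum>j\<in>UNIV. y j p *\<^sub>R d_y j (complex_spray \<alpha>) p) =
      of_real (\<Sum>j\<in>UNIV. N (Inl \<alpha>) j p * y j p) + \<i> * of_real (\<Sum>j\<in>UNIV. N (Inr \<alpha>) j p * y j p)"
    by (simp add: d_y_complex_spray[OF p] scaleR_conv_of_real algebra_simps sum.distrib sum_distrib_left)
  then show "(\<Sum>j\<in>UNIV. y j p *\<^sub>R d_y j (complex_spray \<alpha>) p) = 2 *\<^sub>R complex_spray \<alpha> p"
    unfolding N_euler[OF p] by (simp add: complex_spray_def scaleR_conv_of_real algebra_simps)
qed

text \<open>The complex form of $\delta F^2/\delta x^l = 0$.  The antiholomorphic derivatives drop out by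
  complex linearity of the nonlinear connection.\<close>

lemma d_z_Lc:
  assumes p: "p \<in> S"
  shows "d_z \<mu> Lc p = (\<Sum>\<alpha>\<in>UNIV. Nc \<alpha> \<mu> p * d_v \<alpha> Lc p)"
proof -
  have "d_z \<mu> Lc p = (of_real (\<Sum>k\<in>UNIV. N k (Inl \<mu>) p * d_y k L p)
      - \<i> * of_real (\<Sum>k\<in>UNIV. N k (Inr \<mu>) p * d_y k L p)) / 2"
    unfolding d_z_def d_x_Lc[OF p] horizontal_L[OF p] ..
  also have "\<dots> = (\<Sum>\<alpha>\<in>UNIV. (of_real (N (Inl \<alpha>) (Inl \<mu>) p) + \<i> * of_real (N (Inr \<alpha>) (Inl \<mu>) p)) *
      ((of_real (d_y (Inl \<alpha>) L p) - \<i> * of_real (d_y (Inr \<alpha>) L p)) / 2))"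
    by (simp add: sum_UNIV_Plus N_J[OF p] algebra_simps sum.distrib sum_subtractf sum_distrib_left
        sum_divide_distrib diff_divide_distrib add_divide_distrib sum_negf)
  finally show ?thesis
    by (simp add: d_v_def d_y_Lc[OF p] d_y_complex_spray[OF p])
qed

text \<open>The operator $\partial/\partial\bar v^\tau$ passes through the coefficients because they are holomorphic
  in the fibre.  What results is the equation defining the Chern-Finsler coefficients.\<close>

lemma d_z_d_vbar_Lc:
  assumes p: "p \<in> S"
  shows "d_z \<mu> (d_vbar \<tau> Lc) p = (\<Sum>\<alpha>\<in>UNIV. Nc \<alpha> \<mu> p * d_v \<alpha> (d_vbar \<tau> Lc) p)"
proof -
  have hol: "d_vbar \<tau> (Nc \<alpha> \<mu>) p = 0" for \<alpha>
    using fiber_holomorphic_d_y[OF smooth_complex_spray holomorphic_complex_spray] p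
    unfolding fiber_holomorphic_def by blast
  have "d_z \<mu> (d_vbar \<tau> Lc) p = d_vbar \<tau> (d_z \<mu> Lc) p"
    unfolding wirtinger_operators by (rule wirtinger_commute[OF open_S smooth_Lc p])
  also have "\<dots> = d_vbar \<tau> (\<lambda>q. \<Sum>\<alpha>\<in>UNIV. Nc \<alpha> \<mu> q * d_v \<alpha> Lc q) p"
    unfolding d_vbar_wirtinger
    by (intro wirtinger_cong[OF open_S p d_z_Lc] smooth_complex_derivatives smooth_Lc)
  also have "\<dots> = (\<Sum>\<alpha>\<in>UNIV. Nc \<alpha> \<mu> p * d_vbar \<tau> (d_v \<alpha> Lc) p)"
    unfolding d_vbar_wirtinger
    by (simp add: wirtinger_sum[where S=S] wirtinger_mult[where S=S] smooth_rules smooth_Nc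
        smooth_complex_derivatives smooth_Lc p hol[unfolded d_vbar_wirtinger])
  also have "\<dots> = (\<Sum>\<alpha>\<in>UNIV. Nc \<alpha> \<mu> p * d_v \<alpha> (d_vbar \<tau> Lc) p)"
    unfolding wirtinger_operators by (simp add: wirtinger_commute[OF open_S smooth_Lc p])
  finally show ?thesis .
qed

lemma G_inv_contract:
  assumes p: "p \<in> S"
  shows "(\<Sum>\<tau>\<in>UNIV. G_inv f p $ \<tau> $ \<alpha> * (\<Sum>\<gamma>\<in>UNIV. c \<gamma> * d_v \<gamma> (d_vbar \<tau> Lc) p)) = c \<alpha>"
proof -
  have "(G_mat f p ** G_inv f p) $ \<gamma> $ \<alpha> = (if \<gamma> = \<alpha> then 1 else 0)" for \<gamma>
    using invertible_matrix_inv(1)[OF G_invertible[OF p]] by (simp add: G_inv_def mat_def)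
  then have inv: "(\<Sum>\<tau>\<in>UNIV. d_v \<gamma> (d_vbar \<tau> Lc) p * G_inv f p $ \<tau> $ \<alpha>) = (if \<gamma> = \<alpha> then 1 else 0)" for \<gamma>
    by (simp add: matrix_matrix_mult_def G_mat_def)
  have "(\<Sum>\<tau>\<in>UNIV. G_inv f p $ \<tau> $ \<alpha> * (\<Sum>\<gamma>\<in>UNIV. c \<gamma> * d_v \<gamma> (d_vbar \<tau> Lc) p)) =
      (\<Sum>\<gamma>\<in>UNIV. c \<gamma> * (\<Sum>\<tau>\<in>UNIV. d_v \<gamma> (d_vbar \<tau> Lc) p * G_inv f p $ \<tau> $ \<alpha>))"
    unfolding sum_distrib_left by (subst sum.swap) (simp add: mult_ac)
  also have "\<dots> = c \<alpha>" unfolding inv by (simp add: mult_delta_right)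
  finally show ?thesis .
qed

lemma CF_nonlin_eq: "p \<in> S \<Longrightarrow> CF_nonlin f \<alpha> \<mu> p = Nc \<alpha> \<mu> p"
  unfolding CF_nonlin_def by (simp add: d_z_d_vbar_Lc G_inv_contract)

lemma delta_z_G:
  assumes p: "p \<in> S"
  shows "delta_z f \<mu> (\<lambda>q. G_mat f q $ \<beta> $ \<tau>) p =
    (\<Sum>\<gamma>\<in>UNIV. d_v \<beta> (Nc \<gamma> \<mu>) p * d_v \<gamma> (d_vbar \<tau> Lc) p)"
proof -
  let ?X = "d_vbar \<tau> Lc"
  have X: "C_infinity_on ?X S" by (intro smooth_complex_derivatives smooth_Lc)
  have "d_z \<mu> (d_v \<beta> ?X) p = d_v \<beta> (d_z \<mu> ?X) p"
    unfolding d_z_wirtinger d_v_wirtinger by (rule wirtinger_commute[OF open_S X p])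
  also have "\<dots> = d_v \<beta> (\<lambda>q. \<Sum>\<gamma>\<in>UNIV. Nc \<gamma> \<mu> q * d_v \<gamma> ?X q) p"
    unfolding d_v_wirtinger[of \<beta>]
    by (intro wirtinger_cong[OF open_S p d_z_d_vbar_Lc] smooth_complex_derivatives smooth_Lc)
  also have "\<dots> = (\<Sum>\<gamma>\<in>UNIV. Nc \<gamma> \<mu> p * d_v \<beta> (d_v \<gamma> ?X) p + d_v \<beta> (Nc \<gamma> \<mu>) p * d_v \<gamma> ?X p)"
    unfolding d_v_wirtinger[of \<beta>]
    by (simp add: wirtinger_sum[where S=S] wirtinger_mult[where S=S] smooth_rules smooth_Nc
        smooth_complex_derivatives X p)
  also have "\<dots> = (\<Sum>\<gamma>\<in>UNIV. Nc \<gamma> \<mu> p * d_v \<gamma> (d_v \<beta> ?X) p + d_v \<beta> (Nc \<gamma> \<mu>) p * d_v \<gamma> ?X p)"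
    unfolding d_v_wirtinger by (simp add: wirtinger_commute[OF open_S X p])
  finally show ?thesis
    unfolding delta_z_def G_mat_nth CF_nonlin_eq[OF p] by (simp add: sum.distrib)
qed

text \<open>The Chern-Finsler connection coefficients are the second fibre derivatives of the complex
  spray, hence symmetric in $\beta,\mu$, holomorphic in the fibre and of degree 0.\<close>

lemma CF_conn_eq:
  assumes p: "p \<in> S"
  shows "CF_conn f \<alpha> \<beta> \<mu> p = d_y (Inl \<beta>) (Nc \<alpha> \<mu>) p"
proof -
  have "CF_conn f \<alpha> \<beta> \<mu> p = d_v \<beta> (Nc \<alpha> \<mu>) p"
    unfolding CF_conn_def delta_z_G[OF p] by (rule G_inv_contract[OF p])
  also have "\<dots> = d_y (Inl \<beta>) (Nc \<alpha> \<mu>) p"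
    by (intro fiber_holomorphic_Cauchy_Riemann fiber_holomorphic_d_y smooth_complex_spray
        holomorphic_complex_spray p)
  finally show ?thesis .
qed

lemma CF_conn_sym: "p \<in> S \<Longrightarrow> CF_conn f \<alpha> \<beta> \<mu> p = CF_conn f \<alpha> \<mu> \<beta> p"
  by (simp add: CF_conn_eq d_y_d_y[OF smooth_complex_spray])

lemma CF_conn_fiber_constant:
  assumes "CARD('n) \<ge> 2" "z \<in> U" "v \<noteq> 0" "w \<noteq> 0"
  shows "CF_conn f \<alpha> \<beta> \<mu> (z, v) = CF_conn f \<alpha> \<beta> \<mu> (z, w)"
proof -
  let ?h = "d_y (Inl \<beta>) (Nc \<alpha> \<mu>)"
  have "?h (z, v) = ?h (z, w)"
  proof (rule fiber_constant)
    show "C_infinity_on ?h S" by (intro smooth_rules smooth_complex_spray)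
    show "fiber_holomorphic ?h"
      by (intro fiber_holomorphic_d_y smooth_Nc smooth_complex_spray holomorphic_complex_spray)
    show "fiber_homogeneous 0 ?h"
      using fiber_homogeneous_d_y[OF smooth_Nc
        fiber_homogeneous_d_y[OF smooth_complex_spray homogeneous_complex_spray]] by simp
  qed (use assms in auto)
  then show ?thesis using assms by (simp add: CF_conn_eq)
qed

end

section \<open>Coordinates on the holomorphic tangent bundle\<close>

lemma chart_properties:
  assumes M: "complex_manifold M A" and c: "c \<in> A"
  shows "fst c \<subseteq> topspace M" "inj_on (snd c) (fst c)" "open (snd c ` fst c)"
    "d \<in> A \<Longrightarrow> open (snd c ` (fst c \<inter> fst d))"
proof -
  have op: "openin M (fst c)" and U: "open (snd c ` fst c)"
    and hom: "homeomorphic_map (subtopology M (fst c)) (top_of_set (snd c ` fst c)) (snd c)"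
    using M c unfolding complex_manifold_def by auto
  show sub: "fst c \<subseteq> topspace M" using op by (rule openin_subset)
  have top: "topspace (subtopology M (fst c)) = fst c" using sub by auto
  show "inj_on (snd c) (fst c)" using homeomorphic_imp_injective_map[OF hom] unfolding top .
  show "open (snd c ` fst c)" by fact
  assume "d \<in> A"
  then have "openin M (fst d)" using M unfolding complex_manifold_def by auto
  then have "openin (subtopology M (fst c)) (fst c \<inter> fst d)"
    by (metis inf_commute openin_subtopology)
  then have "openin (top_of_set (snd c ` fst c)) (snd c ` (fst c \<inter> fst d))"
    using homeomorphic_imp_open_map[OF hom] unfolding open_map_def by blast
  then show "open (snd c ` (fst c \<inter> fst d))"
    using U openin_open_trans by blast
qed

lemma chart_inv_of: "inj_on (snd c) (fst c) \<Longrightarrow> p \<in> fst c \<Longrightarrow> chart_inv c (snd c p) = p"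
  by (simp add: chart_inv_def)

lemma transition_differentiable:
  assumes "complex_manifold M A" "c \<in> A" "d \<in> A" "p \<in> fst c" "p \<in> fst d"
  shows "transition c d differentiable (at (snd c p))"
  using assms unfolding complex_manifold_def holomorphic_map_on_def differentiable_def by blast

text \<open>The compatibility of the components in two charts is the chain rule for the transition maps
  on the open overlap.\<close>

lemma tvec_of_tangent:
  assumes M: "complex_manifold M A" and c: "c \<in> A" and p: "p \<in> fst c"
  shows "tvec_of A c p v \<in> tangent_space A p"
  unfolding tangent_space_def
proof (intro CollectI conjI allI ballI impI)
  fix d assume "\<not> (d \<in> A \<and> p \<in> fst d)"
  then show "tvec_of A c p v d = 0" by (auto simp: tvec_of_def)
next
  fix d e assume d: "d \<in> A" and e: "e \<in> A" and pde: "p \<in> fst d \<and> p \<in> fst e"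
  note inv_c = chart_inv_of[OF chart_properties(2)[OF M c]] and inv_d = chart_inv_of[OF chart_properties(2)[OF M d]]
  have val: "transition c d (snd c q) = snd d q" if "q \<in> fst c" for q
    using that by (simp add: transition_def inv_c)
  let ?D = "frechet_derivative (transition c d) (at (snd c p))"
  let ?E = "frechet_derivative (transition d e) (at (snd d p))"
  have D: "(transition c d has_derivative ?D) (at (snd c p))"
    using transition_differentiable[OF M c d] p pde frechet_derivative_works by blast
  have E: "(transition d e has_derivative ?E) (at (transition c d (snd c p)))"
    using transition_differentiable[OF M d e] pde frechet_derivative_works unfolding val[OF p] by blast
  have "((\<lambda>w. transition d e (transition c d w)) has_derivative (\<lambda>w. ?E (?D w))) (at (snd c p))"
    by (rule has_derivative_compose[OF D E])
  then have "(transition c e has_derivative (\<lambda>w. ?E (?D w))) (at (snd c p))"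
  proof (rule has_derivative_transform_within_open)
    show "open (snd c ` (fst c \<inter> fst d))" by (rule chart_properties(4)[OF M c d])
    fix w assume "w \<in> snd c ` (fst c \<inter> fst d)"
    then obtain q where q: "q \<in> fst c" "q \<in> fst d" "w = snd c q" by blast
    then show "transition d e (transition c d w) = transition c e w"
      by (simp add: val) (simp add: transition_def inv_c inv_d)
  qed (use p pde in auto)
  then have "frechet_derivative (transition c e) (at (snd c p)) = (\<lambda>w. ?E (?D w))"
    using frechet_derivative_at by metis
  then show "tvec_of A c p v e = ?E (tvec_of A c p v d)"
    using d e pde by (simp add: tvec_of_def)
qed

lemma tvec_of_scaleR:
  assumes M: "complex_manifold M A" and c: "c \<in> A" and p: "p \<in> fst c"
  shows "tvec_of A c p (t *\<^sub>R v) = tvec_scale (of_real t) (tvec_of A c p v)"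
proof
  fix d
  have "frechet_derivative (transition c d) (at (snd c p)) (t *\<^sub>R v) =
      t *\<^sub>R frechet_derivative (transition c d) (at (snd c p)) v" if "d \<in> A" "p \<in> fst d"
    using linear_frechet_derivative[OF transition_differentiable[OF M c that(1) p that(2)]]
    by (simp add: linear_cmul)
  moreover have "t *\<^sub>R w = of_real t *s w" for w :: "complex ^ 'b"
    by (simp add: vec_eq_iff) (simp add: scaleR_conv_of_real)
  ultimately show "tvec_of A c p (t *\<^sub>R v) d = tvec_scale (of_real t) (tvec_of A c p v) d"
    by (simp add: tvec_of_def tvec_scale_def)
qed

lemma local_rep_J_parallel:
  assumes M: "complex_manifold M A" and F: "strongly_convex_complex_Finsler M A F"
    and J: "J_horizontally_parallel A F" and c: "c \<in> A"
  shows "J_parallel_Finsler_rep (snd c ` fst c) (local_rep A F c)"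
proof
  note slit = slit_domain_def[of c, symmetric]
  have Fc: "C_infinity_on (local_rep A F c) (slit_domain c)"
    "\<forall>p \<in> slit_domain c. \<forall>u. u \<noteq> 0 \<longrightarrow> u \<bullet> (g_mat (local_rep A F c) p *v u) > 0"
    using bspec[OF conjunct2[OF F[unfolded strongly_convex_complex_Finsler_def]] c] by simp_all
  show U: "open (snd c ` fst c)" by (rule chart_properties(3)[OF M c])
  show "C_infinity_on (local_rep A F c) (snd c ` fst c \<times> - {0})"
    unfolding slit by (rule Fc(1))
  show "u \<bullet> (g_mat (local_rep A F c) p *v u) > 0" if "p \<in> snd c ` fst c \<times> - {0}" "u \<noteq> 0" for p u
    using Fc(2) that unfolding slit by simp
  show "local_rep A F c (z, t *\<^sub>R v) = t * local_rep A F c (z, v)"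
    if z: "z \<in> snd c ` fst c" and "v \<noteq> 0" and t: "t > 0" for z v t
  proof -
    obtain p where p: "p \<in> fst c" "z = snd c p" using z by blast
    then have inv: "chart_inv c z = p" by (simp add: chart_inv_of chart_properties(2)[OF M c])
    have "(p, tvec_of A c p v) \<in> tangent_bundle M A"
      using chart_properties(1)[OF M c] p tvec_of_tangent[OF M c p(1)]
      by (auto simp: tangent_bundle_def)
    then have "F (p, tvec_scale (of_real t) (tvec_of A c p v)) =
        norm (complex_of_real t) * F (p, tvec_of A c p v)"
      using bspec[OF conjunct1[OF F[unfolded strongly_convex_complex_Finsler_def]]] by fastforce
    then show ?thesis
      using t by (simp add: local_rep_def inv tvec_of_scaleR[OF M c p(1)])
  qed
  show "Cartan_connection (local_rep A F c) p X (\<lambda>_. J_vert Y) =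
      J_vert (Cartan_connection (local_rep A F c) p X (\<lambda>_. Y))"
    if p: "p \<in> snd c ` fst c \<times> - {0}" and X: "X \<in> horizontal_space (local_rep A F c) p" for p X Y
  proof -
    have "open (slit_domain c)" unfolding slit_domain_def using U by (intro open_Times) auto
    moreover have "C_infinity_on (\<lambda>_. Y) (slit_domain c)" by (rule smooth_const)
    ultimately show ?thesis
      using bspec[OF J[unfolded J_horizontally_parallel_def] c] p X unfolding slit by auto
  qed
qed

theorem theorem3p11:
  fixes M :: "'m topology"
    and A :: "('m, 'n::finite) chart set"
    and F :: "'m \<times> ('m, 'n) tvec \<Rightarrow> real"
  assumes "complex_manifold M A"
    and "CARD('n) \<ge> 2"
    and "strongly_convex_complex_Finsler M A F"
    and "J_horizontally_parallel A F"
  shows "Kaehler_Berwald A F"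
proof -
  have rep: "J_parallel_Finsler_rep (snd c ` fst c) (local_rep A F c)" if "c \<in> A" for c
    using local_rep_J_parallel assms that by blast
  have "Kaehler_Finsler A F"
    unfolding Kaehler_Finsler_def slit_domain_def
    by (intro ballI allI) (rule J_parallel_Finsler_rep.CF_conn_sym[OF rep])
  moreover have "complex_Berwald A F"
    unfolding complex_Berwald_def slit_domain_def
    using J_parallel_Finsler_rep.CF_conn_fiber_constant[OF rep assms(2)] by auto
  ultimately show ?thesis unfolding Kaehler_Berwald_def by blast
qed

end
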